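(* Let $\mathbb{F}$ be a finite field with $q$ elements, and let $G,G'\in\mathbb{F}[z]^{k\times n}$ be two minimal generator matrices that generate the same convolutional code $\mathcal{C}=\operatorname{im}G=\operatorname{im}G'\subseteq\mathbb{F}((z))^n$, with overall constraint length $\gamma>0$. Put $s=q^{\gamma}$. Let $\Lambda_G,\Lambda_{G'}\in\mathbb{Q}[W]^{s\times s}$ be the adjacency matrices of $G$ and $G'$, each formed with respect to an arbitrary ordering of the state space $\mathbb{F}^\gamma$ in which the zero state comes first. Then $\overline{\Lambda_G}=\overline{\Lambda_{G'}}$; that is, there exists a permutation matrix $\Pi\in GL_s(\mathbb{Q})$ with $\Pi_{0,0}=1$ such that $\Lambda_{G'}=\Pi\Lambda_G\Pi^{-1}$.
   Context: Let $\mathbb{F}$ be a finite field with $q$ elements. **Codes.** A matrix $G\in\mathbb{F}[z]^{k\times n}$ is *basic* if it has a right inverse in $\mathbb{F}[z]^{n\times k}$. A *convolutional code* of dimension $k$ is a subspace $\mathcal{C}=\operatorname{im}G=\{uG\mid u\in\mathbb{F}((z))^k\}$ of $\mathbb{F}((z))^n$ with $G\in\mathbb{F}[z]^{k\times n}$ basic; such a $G$ is called a *generator matrix*. The *overall constraint length* of $\mathcal{C}$ is the maximal degree of the $k\times k$ minors of $G$; it depends only on $\mathcal{C}$. A generator matrix is *minimal* if the sum of its row degrees (the degree of a row being the maximal degree of its entries) equals the overall constraint length. **Controller canonical form.** Let $G=(g_{ij})\in\mathbb{F}[z]^{k\times n}$ be a minimal generator matrix with row degrees $\gamma_1,\dots,\gamma_k$,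 $\gamma=\sum_i\gamma_i$, and $g_{ij}=\sum_{\nu=0}^{\gamma_i}g_{ij}^{(\nu)}z^\nu$. For each $i$ let $A_i\in\mathbb{F}^{\gamma_i\times\gamma_i}$ have ones on the first superdiagonal and zeros elsewhere, $B_i=(1,0,\dots,0)\in\mathbb{F}^{1\times\gamma_i}$, and let $C_i\in\mathbb{F}^{\gamma_i\times n}$ have $\nu$-th row $(g_{i1}^{(\nu)},\dots,g_{in}^{(\nu)})$, $\nu=1,\dots,\gamma_i$. Put $A=\operatorname{diag}(A_1,\dots,A_k)\in\mathbb{F}^{\gamma\times\gamma}$, $B=\operatorname{diag}(B_1,\dots,B_k)\in\mathbb{F}^{k\times\gamma}$ (block diagonal), let $C\in\mathbb{F}^{\gamma\times n}$ be $C_1,\dots,C_k$ stacked, and $D=(g_{ij}^{(0)})\in\mathbb{F}^{k\times n}$. If $\gamma_i=0$, the corresponding blocks are missing and the $i$-th row of $B$ is zero. **Adjacency matrix.** Let $s=q^\gamma$ and order the state space $\mathbb{F}^\gamma=\{X_0,\dots,X_{s-1}\}$ (row vectors) with $X_0=0$. With $\operatorname{wt}$ the Hamming weight on $\mathbb{F}^n$, for $i,j\in\{0,\dots,s-1\}$ and $\alpha\in\{0,\dots,n\}$ put $\lambda_{i,j}^{(\alpha)}=\#\{u\in\mathbb{F}^k\mid X_j=X_iA+uB,\ \operatorname{wt}(X_iC+uD)=\alpha\}$, except that $\lambda_{0,0}^{(0)}:=0$. The adjacency matrix of $G$ is $\Lambda_G=\big(\sum_{\alpha=0}^n\lambda_{i,j}^{(\alpha)}W^\alpha\big)_{i,j=0,\dots,s-1}\in\mathbb{Q}[W]^{s\times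 s}$. Rows and columns of $s\times s$ matrices are indexed from $0$ to $s-1$. **Equivalence classes.** Let $\mathcal{G}$ be the group of permutation matrices $\Pi\in GL_s(\mathbb{Q})$ with $\Pi_{0,0}=1$. For $\Lambda\in\mathbb{Q}[W]^{s\times s}$ put $\overline{\Lambda}=\{\Pi\Lambda\Pi^{-1}\mid\Pi\in\mathcal{G}\}$. *)

theory Defs
  imports
    "Jordan_Normal_Form.Determinant"
    "Jordan_Normal_Form.DL_Submatrix"
    "HOL-Computational_Algebra.Formal_Laurent_Series"
    "HOL-Computational_Algebra.Polynomial_FPS"
    "HOL-Library.Cardinality"
    "HOL-Combinatorics.Permutations"
begin

unbundle no fps_syntax

text \<open>Vectors are row vectors throughout; \<open>row_mult u A\<close> is the product \<open>u A\<close>.\<close>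

definition row_mult :: "'a::comm_semiring_0 vec \<Rightarrow> 'a mat \<Rightarrow> 'a vec" where
  "row_mult u A = transpose_mat A *\<^sub>v u"

definition fls_of_poly :: "'a::comm_ring_1 poly \<Rightarrow> 'a fls" where
  "fls_of_poly p = fps_to_fls (fps_of_poly p)"


section \<open>Convolutional codes\<close>

definition basic_mat :: "nat \<Rightarrow> nat \<Rightarrow> 'a::field poly mat \<Rightarrow> bool" where
  "basic_mat k n G \<longleftrightarrow> G \<in> carrier_mat k n \<and> (\<exists>H \<in> carrier_mat n k. G * H = 1\<^sub>m k)"

definition code_image :: "nat \<Rightarrow> 'a::field poly mat \<Rightarrow> 'a fls vec set" where
  "code_image k G = {row_mult u (map_mat fls_of_poly G) | u. u \<in> carrier_vec k}"

definition generator_matrix :: "nat \<Rightarrow> nat \<Rightarrow> 'a::field fls vec set \<Rightarrow> 'a poly mat \<Rightarrow> bool" where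
  "generator_matrix k n \<C> G \<longleftrightarrow> basic_mat k n G \<and> \<C> = code_image k G"

definition convolutional_code :: "nat \<Rightarrow> nat \<Rightarrow> 'a::field fls vec set \<Rightarrow> bool" where
  "convolutional_code k n \<C> \<longleftrightarrow> (\<exists>G. generator_matrix k n \<C> G)"

definition max_minor_degree :: "nat \<Rightarrow> nat \<Rightarrow> 'a::field poly mat \<Rightarrow> nat" where
  "max_minor_degree k n G =
     Max {degree (det (submatrix G UNIV J)) | J. J \<subseteq> {..<n} \<and> card J = k}"

text \<open>The description is well-defined: see \<open>overall_constraint_length_eq\<close> below.\<close>

definition overall_constraint_length :: "nat \<Rightarrow> nat \<Rightarrow> 'a::field fls vec set \<Rightarrow> nat" where
  "overall_constraint_length k n \<C> =
     (THE d. \<exists>G. generator_matrix k n \<C> G \<and> d = max_minor_degree k n G)"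

definition row_degree :: "'a::field poly mat \<Rightarrow> nat \<Rightarrow> nat" where
  "row_degree G i = Max {degree (G $$ (i, j)) | j. j < dim_col G}"

definition minimal_generator_matrix ::
    "nat \<Rightarrow> nat \<Rightarrow> 'a::field fls vec set \<Rightarrow> 'a poly mat \<Rightarrow> bool" where
  "minimal_generator_matrix k n \<C> G \<longleftrightarrow> generator_matrix k n \<C> G \<and>
     (\<Sum>i<k. row_degree G i) = overall_constraint_length k n \<C>"

interpretation fls_of_poly_hom: inj_comm_ring_hom "fls_of_poly :: 'a::comm_ring_1 poly \<Rightarrow> 'a fls"
  by unfold_locales
    (auto simp: fls_of_poly_def fps_of_poly_mult fps_of_poly_add fls_times_fps_to_fls
      fps_of_poly_eq_iff[of _ 0, simplified])

lemma generator_matrix_transition: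
  fixes G G' :: "'a::field poly mat"
  assumes G: "generator_matrix k n \<C> G" and G': "generator_matrix k n \<C> G'"
  obtains U where "U \<in> carrier_mat k k" "G' = U * G"
proof -
  let ?h = "map_mat (fls_of_poly :: 'a poly \<Rightarrow> 'a fls)"
  have c: "G \<in> carrier_mat k n" "G' \<in> carrier_mat k n"
    using G G' by (auto simp: generator_matrix_def basic_mat_def)
  obtain H where H: "H \<in> carrier_mat n k" "G * H = 1\<^sub>m k"
    using G by (auto simp: generator_matrix_def basic_mat_def)
  have im: "code_image k G = code_image k G'"
    using G G' by (auto simp: generator_matrix_def)
  have "\<exists>u \<in> carrier_vec k. row (?h G') i = transpose_mat (?h G) *\<^sub>v u" if i: "i < k" for i
  proof -
    have "row_mult (unit_vec k i) (?h G') = row (?h G') i"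
      unfolding row_mult_def
      using c i by (intro eq_vecI) auto
    moreover have "row_mult (unit_vec k i) (?h G') \<in> code_image k G'"
      by (auto simp: code_image_def)
    ultimately show ?thesis
      unfolding im[symmetric] by (auto simp: code_image_def row_mult_def)
  qed
  then obtain u where u: "\<And>i. i < k \<Longrightarrow> u i \<in> carrier_vec k"
    "\<And>i. i < k \<Longrightarrow> row (?h G') i = transpose_mat (?h G) *\<^sub>v u i"
    by metis
  define V where "V = mat k k (\<lambda>(i, j). u i $ j)"
  have V: "V \<in> carrier_mat k k" by (simp add: V_def)
  have rowV: "row V i = u i" if "i < k" for i
    using u(1)[OF that] that by (auto simp: V_def)
  have eq: "?h G' = V * ?h G"
  proof (rule eq_matI)
    fix i j assume "i < dim_row (V * ?h G)" "j < dim_col (V * ?h G)"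
    hence ij: "i < k" "j < n" using V c by auto
    have "?h G' $$ (i, j) = row (?h G') i $ j" using c ij by auto
    also have "\<dots> = (transpose_mat (?h G) *\<^sub>v u i) $ j" by (simp only: u(2)[OF ij(1)])
    also have "\<dots> = col (?h G) j \<bullet> u i" using c ij by simp
    also have "\<dots> = u i \<bullet> col (?h G) j"
      using c ij u(1)[OF ij(1)] by (intro comm_scalar_prod[where n = k]) auto
    also have "\<dots> = (V * ?h G) $$ (i, j)" using c V ij rowV by simp
    finally show "?h G' $$ (i, j) = (V * ?h G) $$ (i, j)" .
  qed (use c V in auto)
  have "?h (G' * H) = ?h G' * ?h H"
    by (rule fls_of_poly_hom.mat_hom_mult[OF c(2) H(1)])
  also have "\<dots> = V * (?h G * ?h H)"
    unfolding eq using V c H by (intro assoc_mult_mat[where ?n\<^sub>2.0 = k]) auto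
  also have "?h G * ?h H = ?h (G * H)"
    by (rule fls_of_poly_hom.mat_hom_mult[OF c(1) H(1), symmetric])
  also have "\<dots> = 1\<^sub>m k" by (simp add: H(2) fls_of_poly_hom.mat_hom_one)
  finally have "?h (G' * H) = V" using V by simp
  hence "?h G' = ?h (G' * H) * ?h G" using eq by simp
  also have "\<dots> = ?h ((G' * H) * G)"
    using c H by (intro fls_of_poly_hom.mat_hom_mult[symmetric]) auto
  finally have "G' = (G' * H) * G" by (rule fls_of_poly_hom.mat_hom_inj)
  thus thesis using that[of "G' * H"] c H by auto
qed

lemma max_minor_degree_eq:
  fixes G G' :: "'a::field poly mat"
  assumes G: "generator_matrix k n \<C> G" and G': "generator_matrix k n \<C> G'"
  shows "max_minor_degree k n G = max_minor_degree k n G'"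
proof -
  have c: "G \<in> carrier_mat k n" "G' \<in> carrier_mat k n"
    using G G' by (auto simp: generator_matrix_def basic_mat_def)
  obtain H where H: "H \<in> carrier_mat n k" "G * H = 1\<^sub>m k"
    using G by (auto simp: generator_matrix_def basic_mat_def)
  obtain U where U: "U \<in> carrier_mat k k" "G' = U * G"
    using generator_matrix_transition[OF G G'] by blast
  obtain V where V: "V \<in> carrier_mat k k" "G = V * G'"
    using generator_matrix_transition[OF G' G] by blast
  have VU: "V * U \<in> carrier_mat k k" using V U by auto
  have "G = (V * U) * G" using V U c assoc_mult_mat[OF V(1) U(1) c(1)] by metis
  hence "(V * U) * (G * H) = G * H"
    using assoc_mult_mat[OF VU c(1) H(1)] by metis
  hence "V * U = 1\<^sub>m k" using H VU by auto
  hence "det V * det U = 1" using det_mult[OF V(1) U(1)] by simp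
  hence dU: "degree (det U) = 0" "det U \<noteq> 0"
    by (metis degree_1 add_is_0 degree_mult_eq mult_zero_left mult_zero_right zero_neq_one)
      (use \<open>det V * det U = 1\<close> in auto)
  have "degree (det (submatrix G' UNIV J)) = degree (det (submatrix G UNIV J))"
    if J: "J \<subseteq> {..<n}" "card J = k" for J
  proof -
    have cJ: "{j. j < n \<and> j \<in> J} = J" using J by auto
    have cr: "{i. i < k \<and> i \<in> (UNIV :: nat set)} = {..<k}" by auto
    have sG: "submatrix G UNIV J \<in> carrier_mat k k"
      using c J cJ cr by (intro carrier_matI) (auto simp: dim_submatrix)
    have "submatrix G' UNIV J = U * submatrix G UNIV J"
    proof (rule eq_matI)
      fix i j assume "i < dim_row (U * submatrix G UNIV J)" "j < dim_col (U * submatrix G UNIV J)"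
      hence ij: "i < k" "j < k" using U sG by auto
      have p: "pick J j < n" using pick_in_set_le[of j J] ij J by auto
      have e: "submatrix M UNIV J $$ (i', j) = M $$ (i', pick J j)"
        if "M \<in> carrier_mat k n" "i' < k" for M :: "'a poly mat" and i'
        using that ij cJ J by (auto simp: submatrix_def pick_UNIV)
      have "col (submatrix G UNIV J) j = col G (pick J j)"
        using e[OF c(1)] sG c p ij by (intro eq_vecI) auto
      thus "submatrix G' UNIV J $$ (i, j) = (U * submatrix G UNIV J) $$ (i, j)"
        using e[OF c(2) ij(1)] U c sG p ij by simp
    qed (use c U sG cJ cr J in \<open>auto simp: dim_submatrix\<close>)
    hence "det (submatrix G' UNIV J) = det U * det (submatrix G UNIV J)"
      using det_mult[OF U(1) sG] by simp
    thus ?thesis using dU by (cases "det (submatrix G UNIV J) = 0") (auto simp: degree_mult_eq)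
  qed
  hence "{degree (det (submatrix G UNIV J)) | J. J \<subseteq> {..<n} \<and> card J = k} =
     {degree (det (submatrix G' UNIV J)) | J. J \<subseteq> {..<n} \<and> card J = k}"
    by (intro Collect_cong ex_cong1) auto
  thus ?thesis by (simp add: max_minor_degree_def)
qed

lemma overall_constraint_length_eq:
  assumes "generator_matrix k n \<C> G"
  shows "overall_constraint_length k n \<C> = max_minor_degree k n G"
  unfolding overall_constraint_length_def
  using assms max_minor_degree_eq by (intro the_equality) blast+


section \<open>Controller canonical form\<close>

text \<open>
  The blocks belong to the \<open>i\<close>-th row of \<open>G\<close>. When its degree is \<open>0\<close>, \<open>ccf_A_block G i\<close> is a
  \<open>0 \<times> 0\<close> matrix and \<open>ccf_B_block G i\<close> is a \<open>1 \<times> 0\<close> matrix, so that the block contributes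
  exactly a zero row to \<open>ccf_B\<close>.
\<close>

definition ccf_A_block :: "'a::field poly mat \<Rightarrow> nat \<Rightarrow> 'a mat" where
  "ccf_A_block G i = mat (row_degree G i) (row_degree G i) (\<lambda>(a, b). if b = Suc a then 1 else 0)"

definition ccf_B_block :: "'a::field poly mat \<Rightarrow> nat \<Rightarrow> 'a mat" where
  "ccf_B_block G i = mat 1 (row_degree G i) (\<lambda>(a, b). if b = 0 then 1 else 0)"

definition coeff_row :: "'a::field poly mat \<Rightarrow> nat \<Rightarrow> nat \<Rightarrow> 'a vec" where
  "coeff_row G i \<nu> = vec (dim_col G) (\<lambda>j. coeff (G $$ (i, j)) \<nu>)"

definition ccf_A :: "'a::field poly mat \<Rightarrow> 'a mat" where
  "ccf_A G = diag_block_mat (map (ccf_A_block G) [0..<dim_row G])"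

definition ccf_B :: "'a::field poly mat \<Rightarrow> 'a mat" where
  "ccf_B G = diag_block_mat (map (ccf_B_block G) [0..<dim_row G])"

definition ccf_C :: "'a::field poly mat \<Rightarrow> 'a mat" where
  "ccf_C G = mat_of_rows (dim_col G)
     (concat (map (\<lambda>i. map (coeff_row G i) [1..<Suc (row_degree G i)]) [0..<dim_row G]))"

definition ccf_D :: "'a::field poly mat \<Rightarrow> 'a mat" where
  "ccf_D G = map_mat (\<lambda>p. coeff p 0) G"


section \<open>Adjacency matrix\<close>

definition hamming_weight :: "'a::zero vec \<Rightarrow> nat" where
  "hamming_weight v = card {i. i < dim_vec v \<and> v $ i \<noteq> 0}"

text \<open>An enumeration \<open>X 0, ..., X (q ^ \<gamma> - 1)\<close> of the state space with the zero state first.\<close>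

definition state_ordering :: "nat \<Rightarrow> (nat \<Rightarrow> 'a::{field, finite} vec) \<Rightarrow> bool" where
  "state_ordering \<gamma> X \<longleftrightarrow>
     bij_betw X {..<CARD('a) ^ \<gamma>} (carrier_vec \<gamma>) \<and> X 0 = 0\<^sub>v \<gamma>"

definition transition_count ::
    "'a::{field, finite} poly mat \<Rightarrow> (nat \<Rightarrow> 'a vec) \<Rightarrow> nat \<Rightarrow> nat \<Rightarrow> nat \<Rightarrow> nat" where
  "transition_count G X i j \<alpha> =
     (if i = 0 \<and> j = 0 \<and> \<alpha> = 0 then 0
      else card {u \<in> carrier_vec (dim_row G).
        X j = row_mult (X i) (ccf_A G) + row_mult u (ccf_B G) \<and>
        hamming_weight (row_mult (X i) (ccf_C G) + row_mult u (ccf_D G)) = \<alpha>})"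

definition adjacency_matrix ::
    "nat \<Rightarrow> 'a::{field, finite} poly mat \<Rightarrow> (nat \<Rightarrow> 'a vec) \<Rightarrow> rat poly mat" where
  "adjacency_matrix s G X = mat s s (\<lambda>(i, j).
     \<Sum>\<alpha>\<le>dim_col G. monom (of_nat (transition_count G X i j \<alpha>)) \<alpha>)"


section \<open>Equivalence classes\<close>

definition permutation_matrix :: "nat \<Rightarrow> rat mat \<Rightarrow> bool" where
  "permutation_matrix s P \<longleftrightarrow>
     (\<exists>\<sigma>. \<sigma> permutes {..<s} \<and> P = mat s s (\<lambda>(i, j). if j = \<sigma> i then 1 else 0))"

definition zero_fixing_perm_group :: "nat \<Rightarrow> rat mat set" where
  "zero_fixing_perm_group s = {P. permutation_matrix s P \<and> P $$ (0, 0) = 1}"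

definition const_poly_mat :: "rat mat \<Rightarrow> rat poly mat" where
  "const_poly_mat P = map_mat (\<lambda>c. [:c:]) P"

text \<open>\<open>perm_conjugate s M N\<close> says that \<open>N = P M P\<^sup>-\<^sup>1\<close> for some \<open>P\<close> in the group; \<open>Q\<close> is \<open>P\<^sup>-\<^sup>1\<close>.\<close>

definition perm_conjugate :: "nat \<Rightarrow> rat poly mat \<Rightarrow> rat poly mat \<Rightarrow> bool" where
  "perm_conjugate s M N \<longleftrightarrow> (\<exists>P \<in> zero_fixing_perm_group s. \<exists>Q \<in> carrier_mat s s.
     P * Q = 1\<^sub>m s \<and> Q * P = 1\<^sub>m s \<and> N = const_poly_mat P * M * const_poly_mat Q)"

definition equivalence_class :: "nat \<Rightarrow> rat poly mat \<Rightarrow> rat poly mat set" where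
  "equivalence_class s M = {N. perm_conjugate s M N}"

end

theory Submission
  imports Defs
begin

text \<open>
  Write \<open>G' = U G\<close> with \<open>U\<close> polynomial. A state \<open>x\<close> is identified with the polynomial vector
  \<open>S x\<close> that the encoder emits from \<open>x\<close> under zero inputs, taken modulo the row module
  \<open>F[z]^k G\<close>. Since \<open>G\<close> is row reduced, the predictable degree property shows that \<open>x\<close> is
  determined by this class, and that \<open>x\<close> passes to \<open>y\<close> with output \<open>v\<close> under some (then unique)
  input if and only if \<open>v + z S y - S x\<close> lies in \<open>F[z]^k G\<close>. The row modules of \<open>G\<close> and \<open>G'\<close>
  coincide, and so do the sets of classes of states; matching states of equal class is therefore a
  bijection which fixes \<open>0\<close> and preserves the number of transitions with output of each weight.
\<close>

unbundle no Formal_Power_Series.fps_syntax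

section \<open>Block indices\<close>

text \<open>Flattens a pair (block, offset) when blocks of sizes \<open>d 0\<close>,
  \<open>d 1\<close>, ... are laid end to end. An empty block occupies no position, so rows of
  degree 0 need no case of their own.\<close>

definition block_pos :: "(nat \<Rightarrow> nat) \<Rightarrow> nat \<Rightarrow> nat \<Rightarrow> nat" where
  "block_pos d i a = (\<Sum>l<i. d l) + a"

lemma block_pos_less:
  assumes "i < k" "a < d i"
  shows "block_pos d i a < (\<Sum>l<k. d l)"
proof -
  have "block_pos d i a < (\<Sum>l<Suc i. d l)" using assms by (simp add: block_pos_def)
  also have "\<dots> \<le> (\<Sum>l<k. d l)" using assms by (intro sum_mono2) auto
  finally show ?thesis .
qed

lemma block_pos_inject:
  assumes "a < d i" "b < d l"
  shows "block_pos d i a = block_pos d l b \<longleftrightarrow> i = l \<and> a = b"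
proof -
  have less: "block_pos d i a < block_pos d l b" if "i < l" "a < d i" for i a l b
    using block_pos_less[of i l a d] that by (simp add: block_pos_def)
  have "i = l" if "block_pos d i a = block_pos d l b"
    using less[of i l a b] less[of l i b a] assms that by (metis less_irrefl linorder_neqE_nat)
  thus ?thesis by (metis add_left_cancel block_pos_def)
qed

lemma block_pos_exhaust:
  assumes "r < (\<Sum>l<k. d l)"
  obtains i a where "i < k" "a < d i" "r = block_pos d i a"
  using assms
proof (induction k arbitrary: thesis)
  case (Suc k)
  show ?case
  proof (cases "r < (\<Sum>l<k. d l)")
    case True
    with Suc.IH Suc.prems(1) show ?thesis by (metis less_Suc_eq)
  next
    case False
    with Suc.prems(2) show ?thesis
      by (intro Suc.prems(1)[of k "r - (\<Sum>l<k. d l)"]) (auto simp: block_pos_def)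
  qed
qed simp

lemma sum_lessThan_add:
  fixes f :: "nat \<Rightarrow> 'b::comm_monoid_add"
  shows "(\<Sum>r<m + e. f r) = (\<Sum>r<m. f r) + (\<Sum>a<e. f (m + a))"
  by (induction e) (auto simp: add.assoc)

lemma sum_block_pos:
  fixes f :: "nat \<Rightarrow> 'b::comm_monoid_add"
  shows "(\<Sum>r<(\<Sum>l<k. d l). f r) = (\<Sum>i<k. \<Sum>a<d i. f (block_pos d i a))"
  by (induction k) (simp_all add: block_pos_def sum_lessThan_add)

text \<open>Rows and columns carry separate size functions because the blocks of
  \<open>ccf_B\<close> are not square. The induction splits off the last block, which is where
  \<open>[0..<Suc k]\<close> grows.\<close>

lemma diag_block_mat_index:
  assumes "i < k" "l < k" "a < dim_row (F i)" "b < dim_col (F l)"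
  shows "diag_block_mat (map F [0..<k]) $$
      (block_pos (\<lambda>i. dim_row (F i)) i a, block_pos (\<lambda>i. dim_col (F i)) l b) =
    (if i = l then F i $$ (a, b) else 0)"
  using assms
proof (induction k)
  case (Suc k)
  let ?D = "diag_block_mat (map F [0..<k])"
  have dims: "dim_row ?D = (\<Sum>i<k. dim_row (F i))" "dim_col ?D = (\<Sum>i<k. dim_col (F i))"
    by (simp_all add: dim_diag_block_mat comp_def interv_sum_list_conv_sum_set_nat atLeast0LessThan)
  have less: "block_pos (\<lambda>i. dim_row (F i)) i a < dim_row ?D" if "i < k"
    using that Suc.prems block_pos_less[of i k a "\<lambda>i. dim_row (F i)"] by (simp add: dims)
  have less': "block_pos (\<lambda>i. dim_col (F i)) l b < dim_col ?D" if "l < k"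
    using that Suc.prems block_pos_less[of l k b "\<lambda>i. dim_col (F i)"] by (simp add: dims)
  have eq: "diag_block_mat (map F [0..<Suc k]) =
      four_block_mat ?D (0\<^sub>m (dim_row ?D) (dim_col (F k))) (0\<^sub>m (dim_row (F k)) (dim_col ?D)) (F k)"
    by (simp add: diag_block_mat_last Let_def)
  consider "i < k" "l < k" | "i < k" "l = k" | "i = k" "l < k" | "i = k" "l = k"
    using Suc.prems by linarith
  thus ?case
  proof cases
    case 1
    then show ?thesis using Suc less less' unfolding eq by simp
  next
    case 2
    then show ?thesis using Suc.prems less unfolding eq by (simp add: block_pos_def dims)
  next
    case 3
    then show ?thesis using Suc.prems less' unfolding eq by (simp add: block_pos_def dims)
  next
    case 4
    then show ?thesis using Suc.prems unfolding eq by (simp add: block_pos_def dims)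
  qed
qed simp

lemma nth_concat_block_pos:
  assumes "i < k" "a < length (F i)"
  shows "concat (map F [0..<k]) ! block_pos (\<lambda>i. length (F i)) i a = F i ! a"
  using assms
proof (induction k)
  case (Suc k)
  have len: "length (concat (map F [0..<k])) = (\<Sum>i<k. length (F i))"
    by (simp add: length_concat comp_def interv_sum_list_conv_sum_set_nat atLeast0LessThan)
  show ?case
  proof (cases "i < k")
    case True
    then show ?thesis using Suc block_pos_less[of i k a "\<lambda>i. length (F i)"]
      by (simp add: nth_append len)
  next
    case False
    then show ?thesis using Suc.prems by (simp add: nth_append len block_pos_def less_Suc_eq)
  qed
qed simp


section \<open>Row-reduced matrices\<close>

lemma degree_le_row_degree:
  assumes "j < dim_col G"
  shows "degree (G $$ (i, j)) \<le> row_degree G i"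
proof -
  have "{degree (G $$ (i, j)) | j. j < dim_col G} = (\<lambda>j. degree (G $$ (i, j))) ` {..<dim_col G}"
    by auto
  thus ?thesis unfolding row_degree_def using assms by (intro Max_ge) auto
qed

lemma coeff_above_row_degree:
  assumes "j < dim_col G" "row_degree G i < m"
  shows "coeff (G $$ (i, j)) m = 0"
  using degree_le_row_degree[OF assms(1), of i] assms(2) by (intro coeff_eq_0) simp

text \<open>Linear independence of the rows of the leading row coefficient matrix, which holds the
  coefficient of \<open>z ^ row_degree G i\<close> in row \<open>i\<close>.\<close>

definition row_reduced :: "'a::field poly mat \<Rightarrow> bool" where
  "row_reduced G \<longleftrightarrow> (\<forall>c. (\<forall>j<dim_col G.
      (\<Sum>i<dim_row G. c i * coeff (G $$ (i, j)) (row_degree G i)) = 0) \<longrightarrow>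
    (\<forall>i<dim_row G. c i = 0))"

section \<open>Coefficients of products and determinants at degree bounds\<close>

lemma degree_prod_le_sum:
  fixes f :: "'b \<Rightarrow> 'a::comm_semiring_1 poly"
  assumes "\<And>i. i \<in> I \<Longrightarrow> degree (f i) \<le> d i"
  shows "degree (\<Prod>i\<in>I. f i) \<le> (\<Sum>i\<in>I. d i)"
  using assms
proof (induction I rule: infinite_finite_induct)
  case (insert i I)
  have "degree (f i * prod f I) \<le> d i + sum d I"
    using insert by (intro order.trans[OF degree_mult_le] add_mono) auto
  with insert show ?case by simp
qed auto

text \<open>In every other term of the convolution one index exceeds its bound. Since
  \<open>a\<close> and \<open>b\<close> are only bounds, the formula also covers vanishing leading
  coefficients.\<close>

lemma coeff_mult_at_bounds:
  assumes "degree p \<le> a" "degree q \<le> b"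
  shows "coeff (p * q) (a + b) = coeff p a * coeff q b"
proof -
  have "coeff p i * coeff q (a + b - i) = 0" if "i \<le> a + b" "i \<noteq> a" for i
  proof (cases "i < a")
    case True
    then show ?thesis using assms by (simp add: coeff_eq_0)
  next
    case False
    then show ?thesis using assms that by (simp add: coeff_eq_0)
  qed
  hence "(\<Sum>i\<le>a + b. coeff p i * coeff q (a + b - i)) =
      (\<Sum>i\<in>{a}. coeff p i * coeff q (a + b - i))"
    by (intro sum.mono_neutral_right) auto
  thus ?thesis by (simp add: coeff_mult)
qed

lemma coeff_prod_at_sum:
  fixes f :: "'b \<Rightarrow> 'a::comm_semiring_1 poly"
  assumes "finite I" "\<And>i. i \<in> I \<Longrightarrow> degree (f i) \<le> d i"
  shows "coeff (\<Prod>i\<in>I. f i) (\<Sum>i\<in>I. d i) = (\<Prod>i\<in>I. coeff (f i) (d i))"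
  using assms
  by (induction I) (auto simp: coeff_mult_at_bounds degree_prod_le_sum)

text \<open>Each Leibniz product takes exactly one entry from every row, so the row bounds add up to
  the same total for all permutations and the coefficient can be read off termwise.\<close>

lemma coeff_det_at_sum:
  fixes M :: "'a::field poly mat"
  assumes M: "M \<in> carrier_mat k k"
    and d: "\<And>i j. i < k \<Longrightarrow> j < k \<Longrightarrow> degree (M $$ (i, j)) \<le> d i"
  shows "coeff (det M) (\<Sum>i<k. d i) = det (mat k k (\<lambda>(i, j). coeff (M $$ (i, j)) (d i)))"
proof -
  have *: "coeff (\<Prod>i = 0..<k. M $$ (i, p i)) (\<Sum>i<k. d i) = (\<Prod>i = 0..<k. coeff (M $$ (i, p i)) (d i))"
    if "p permutes {0..<k}" for p
    unfolding atLeast0LessThan[symmetric]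
    using d permutes_in_image[OF that] by (intro coeff_prod_at_sum) auto
  have s: "coeff (signof p * q) m = signof p * coeff q m" for p :: "nat \<Rightarrow> nat" and q :: "'a poly" and m
    by (auto simp: sign_def)
  have "coeff (det M) (\<Sum>i<k. d i) =
      (\<Sum>p | p permutes {0..<k}. signof p * (\<Prod>i = 0..<k. coeff (M $$ (i, p i)) (d i)))"
    by (auto simp: det_def'[OF M] coeff_sum s * intro!: sum.cong)
  also have "\<dots> = det (mat k k (\<lambda>(i, j). coeff (M $$ (i, j)) (d i)))"
    unfolding det_def'[OF mat_carrier]
    by (intro sum.cong refl arg_cong2[of _ _ _ _ "(*)"] prod.cong) (auto dest!: permutes_in_image)
  finally show ?thesis .
qed

text \<open>If \<open>n < k\<close>, padding both factors with zeros to square matrices keeps the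
  product, while the padded \<open>G\<close> acquires a zero column and hence determinant 0. The
  bound guarantees that there are \<open>k\<close>-element column sets, so that the maximal minor
  degree is attained.\<close>

lemma rank_bound_of_right_inverse:
  fixes G :: "'a::idom mat"
  assumes G: "G \<in> carrier_mat k n" and H: "H \<in> carrier_mat n k" and GH: "G * H = 1\<^sub>m k"
  shows "k \<le> n"
proof (rule ccontr)
  assume "\<not> k \<le> n"
  hence "n < k" by simp
  define G1 where "G1 = mat k k (\<lambda>(i, j). if j < n then G $$ (i, j) else 0)"
  define H1 where "H1 = mat k k (\<lambda>(i, j). if i < n then H $$ (i, j) else 0)"
  have c: "G1 \<in> carrier_mat k k" "H1 \<in> carrier_mat k k" by (auto simp: G1_def H1_def)
  have "G1 * H1 = G * H"
  proof (rule eq_matI)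
    fix i j assume "i < dim_row (G * H)" "j < dim_col (G * H)"
    hence ij: "i < k" "j < k" using G H by auto
    have "(G1 * H1) $$ (i, j) = (\<Sum>r = 0..<k. G1 $$ (i, r) * H1 $$ (r, j))"
      using c ij by (simp add: scalar_prod_def)
    also have "\<dots> = (\<Sum>r = 0..<n. G $$ (i, r) * H $$ (r, j))"
      using \<open>n < k\<close> ij by (intro sum.mono_neutral_cong_right) (auto simp: G1_def H1_def)
    also have "\<dots> = (G * H) $$ (i, j)" using G H ij by (simp add: scalar_prod_def)
    finally show "(G1 * H1) $$ (i, j) = (G * H) $$ (i, j)" .
  qed (use c G H in auto)
  hence "det G1 * det H1 = 1" using det_mult[OF c] GH by simp
  moreover have "det G1 = 0"
  proof -
    have "G1 *\<^sub>v unit_vec k n = 0\<^sub>v k"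
      using \<open>n < k\<close> by (intro eq_vecI) (auto simp: G1_def scalar_prod_right_unit)
    moreover have "unit_vec k n \<noteq> 0\<^sub>v k" using \<open>n < k\<close> by simp
    ultimately show ?thesis
      unfolding det_0_iff_vec_prod_zero[OF c(1)] by (intro exI[of _ "unit_vec k n"]) simp
  qed
  ultimately show False by simp
qed

text \<open>In degree equal to the sum of the row degrees, the coefficient of the minor is a maximal
  minor of the leading row coefficient matrix. Once it is nonzero, the rows of that matrix are
  independent.\<close>

lemma row_reduced_if_minor:
  fixes G :: "'a::field poly mat"
  assumes G: "G \<in> carrier_mat k n" and J: "J \<subseteq> {..<n}" "card J = k"
    and deg: "degree (det (submatrix G UNIV J)) = (\<Sum>i<k. row_degree G i)"
    and nz: "det (submatrix G UNIV J) \<noteq> 0"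
  shows "row_reduced G"
proof -
  let ?M = "submatrix G UNIV J"
  have cJ: "{j. j < n \<and> j \<in> J} = J" using J by auto
  have cr: "{i. i < k \<and> i \<in> (UNIV :: nat set)} = {..<k}" by auto
  have M: "?M \<in> carrier_mat k k"
    using G J cJ cr by (intro carrier_matI) (auto simp: dim_submatrix)
  have p: "pick J j < n" if "j < k" for j using pick_in_set_le[of j J] that J by auto
  have e: "?M $$ (i, j) = G $$ (i, pick J j)" if "i < k" "j < k" for i j
    using that G cJ J by (auto simp: submatrix_def pick_UNIV)
  define L where "L = mat k k (\<lambda>(i, j). coeff (?M $$ (i, j)) (row_degree G i))"
  have L: "L \<in> carrier_mat k k" by (simp add: L_def)
  have "coeff (det ?M) (\<Sum>i<k. row_degree G i) = det L"
    unfolding L_def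
  proof (rule coeff_det_at_sum[OF M])
    fix i j assume "i < k" "j < k"
    thus "degree (?M $$ (i, j)) \<le> row_degree G i"
      using e p G degree_le_row_degree[of "pick J j" G i] by simp
  qed
  hence "det L \<noteq> 0" using deg nz by (metis leading_coeff_0_iff)
  hence dL: "det (transpose_mat L) \<noteq> 0" using det_transpose[OF L] by simp
  show ?thesis unfolding row_reduced_def
  proof (intro allI impI)
    fix c i
    assume *: "\<forall>j<dim_col G. (\<Sum>i<dim_row G. c i * coeff (G $$ (i, j)) (row_degree G i)) = 0"
      and i: "i < dim_row G"
    \<comment> \<open>The relation among the rows, restricted to the columns in \<open>J\<close>,
      becomes a kernel vector of the transpose.\<close>
    have "transpose_mat L *\<^sub>v vec k c = 0\<^sub>v k"
    proof (rule eq_vecI)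
      fix j assume "j < dim_vec (0\<^sub>v k :: 'a vec)"
      hence j: "j < k" by simp
      have "(transpose_mat L *\<^sub>v vec k c) $ j = (\<Sum>i<k. c i * coeff (G $$ (i, pick J j)) (row_degree G i))"
        using j L e by (auto simp: scalar_prod_def L_def atLeast0LessThan mult.commute intro!: sum.cong)
      also have "\<dots> = 0" using * G p[OF j] by auto
      finally show "(transpose_mat L *\<^sub>v vec k c) $ j = 0\<^sub>v k $ j" using j by simp
    qed (use L in simp)
    hence "vec k c = 0\<^sub>v k"
      using dL det_0_iff_vec_prod_zero_field[of "transpose_mat L" k] L vec_carrier[of k c]
      by (metis transpose_carrier_mat)
    thus "c i = 0" using i G by (metis carrier_matD(1) index_vec index_zero_vec(1))
  qed
qed

lemma minimal_generator_matrix_row_reduced: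
  fixes G :: "'a::field poly mat"
  assumes G: "minimal_generator_matrix k n \<C> G" and pos: "overall_constraint_length k n \<C> > 0"
  shows "row_reduced G"
proof -
  have gen: "generator_matrix k n \<C> G" using G by (simp add: minimal_generator_matrix_def)
  then obtain H where c: "G \<in> carrier_mat k n" and H: "H \<in> carrier_mat n k" "G * H = 1\<^sub>m k"
    by (auto simp: generator_matrix_def basic_mat_def)
  have "k \<le> n" by (rule rank_bound_of_right_inverse[OF c H])
  let ?S = "{degree (det (submatrix G UNIV J)) | J. J \<subseteq> {..<n} \<and> card J = k}"
  have "finite {J. J \<subseteq> {..<n} \<and> card J = k}" by simp
  hence fin: "finite ?S" by simp
  have "degree (det (submatrix G UNIV {..<k})) \<in> ?S" using \<open>k \<le> n\<close> by force
  hence "Max ?S \<in> ?S" using fin by (intro Max_in) auto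
  moreover have deg: "(\<Sum>i<k. row_degree G i) = Max ?S"
    using G overall_constraint_length_eq[OF gen]
    by (simp add: minimal_generator_matrix_def max_minor_degree_def)
  ultimately obtain J where J: "J \<subseteq> {..<n}" "card J = k"
    "degree (det (submatrix G UNIV J)) = (\<Sum>i<k. row_degree G i)" by auto
  \<comment> \<open>The zero polynomial has degree 0 by convention, so a positive degree is what
    shows the chosen minor to be nonzero.\<close>
  moreover have "(\<Sum>i<k. row_degree G i) > 0"
    using G pos by (simp add: minimal_generator_matrix_def)
  ultimately show ?thesis by (intro row_reduced_if_minor[OF c J]) auto
qed

text \<open>Forney's predictable degree property.\<close>

lemma row_reduced_coeff_eq_0:
  fixes G :: "'a::field poly mat"
  assumes G: "G \<in> carrier_mat k n" and red: "row_reduced G"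
    and zero: "\<And>j d. j < n \<Longrightarrow> D \<le> d \<Longrightarrow> coeff (\<Sum>i<k. p i * G $$ (i, j)) d = 0"
    and i: "i < k" and m: "D \<le> m + row_degree G i"
  shows "coeff (p i) m = 0"
proof (rule ccontr)
  assume nz: "coeff (p i) m \<noteq> 0"
  \<comment> \<open>The degrees in which a nonzero coefficient of some \<open>p i\<close> meets the
    leading coefficients of row \<open>i\<close>. At the maximum of \<open>T\<close> nothing else
    contributes, so only leading coefficients are involved there.\<close>
  define T where "T = {m + row_degree G i | m i. i < k \<and> coeff (p i) m \<noteq> 0}"
  have "T \<subseteq> {..(\<Sum>i<k. degree (p i) + row_degree G i)}"
  proof
    fix t assume "t \<in> T"
    then obtain m i where t: "t = m + row_degree G i" "i < k" "coeff (p i) m \<noteq> 0"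
      by (auto simp: T_def)
    hence "t \<le> degree (p i) + row_degree G i" by (simp add: le_degree)
    also have "\<dots> \<le> (\<Sum>i<k. degree (p i) + row_degree G i)"
      using t(2) by (intro member_le_sum) auto
    finally show "t \<in> {..(\<Sum>i<k. degree (p i) + row_degree G i)}" by simp
  qed
  hence fin: "finite T" by (rule finite_subset) simp
  have mem: "m + row_degree G i \<in> T" using i nz by (auto simp: T_def)
  define d where "d = Max T"
  have "d \<in> T" unfolding d_def using fin mem by (intro Max_in) auto
  then obtain m' i' where d: "d = m' + row_degree G i'" "i' < k" "coeff (p i') m' \<noteq> 0"
    by (auto simp: T_def)
  have "D \<le> d" using Max_ge[OF fin mem] m by (simp add: d_def)
  have above: "coeff (p l) r = 0" if "l < k" "d < r + row_degree G l" for l r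
  proof (rule ccontr)
    assume "coeff (p l) r \<noteq> 0"
    with that(1) have "r + row_degree G l \<in> T" by (auto simp: T_def)
    thus False using that(2) Max_ge[OF fin] by (fastforce simp: d_def)
  qed
  \<comment> \<open>The multipliers of the leading coefficients in degree \<open>d\<close>. If
    \<open>row_degree G l\<close> exceeds \<open>d\<close>, then \<open>p l\<close> is zero by
    \<open>above\<close>; the case split keeps truncated subtraction from producing a wrong
    coefficient.\<close>
  define c where "c l = (if row_degree G l \<le> d then coeff (p l) (d - row_degree G l) else 0)" for l
  have "c l = 0" if "l < k" for l
  proof -
    have "(\<Sum>i<k. c i * coeff (G $$ (i, j)) (row_degree G i)) = 0" if j: "j < n" for j
    proof -
      have "coeff (p i * G $$ (i, j)) d = c i * coeff (G $$ (i, j)) (row_degree G i)" if "i < k" for i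
      proof (cases "row_degree G i \<le> d")
        case True
        have "degree (p i) \<le> d - row_degree G i"
          using above[OF that] True by (intro degree_le) auto
        moreover have "degree (G $$ (i, j)) \<le> row_degree G i"
          using G j by (intro degree_le_row_degree) auto
        ultimately show ?thesis
          using coeff_mult_at_bounds[of "p i" "d - row_degree G i" "G $$ (i, j)" "row_degree G i"] True
          by (simp add: c_def)
      next
        case False
        hence "p i = 0" using above[OF that] by (intro poly_eqI) auto
        thus ?thesis using False by (simp add: c_def)
      qed
      hence "(\<Sum>i<k. c i * coeff (G $$ (i, j)) (row_degree G i)) = coeff (\<Sum>i<k. p i * G $$ (i, j)) d"
        by (simp add: coeff_sum)
      thus ?thesis using zero[OF j \<open>D \<le> d\<close>] by simp
    qed
    thus ?thesis using red G that unfolding row_reduced_def by auto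
  qed
  from this[OF d(2)] d show False by (simp add: c_def)
qed


section \<open>The state space as polynomial vectors modulo the row module\<close>

text \<open>Membership in the row module. Vectors are functions constrained only below
  \<open>dim_col G\<close>, which allows pointwise arithmetic without carrier conditions.\<close>

definition in_row_span :: "'a::comm_ring_1 mat \<Rightarrow> (nat \<Rightarrow> 'a) \<Rightarrow> bool" where
  "in_row_span G w \<longleftrightarrow> (\<exists>a. \<forall>j<dim_col G. w j = (\<Sum>i<dim_row G. a i * G $$ (i, j)))"

lemma in_row_spanI:
  assumes "\<And>j. j < dim_col G \<Longrightarrow> w j = (\<Sum>i<dim_row G. a i * G $$ (i, j))"
  shows "in_row_span G w"
  using assms by (auto simp: in_row_span_def)

lemma in_row_spanE:
  assumes "in_row_span G w"
  obtains a where "\<And>j. j < dim_col G \<Longrightarrow> w j = (\<Sum>i<dim_row G. a i * G $$ (i, j))"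
  using assms by (auto simp: in_row_span_def)

lemma in_row_span_add:
  assumes "in_row_span G v" "in_row_span G w"
  shows "in_row_span G (\<lambda>j. v j + w j)"
proof -
  from assms obtain a b where "\<And>j. j < dim_col G \<Longrightarrow> v j = (\<Sum>i<dim_row G. a i * G $$ (i, j))"
    "\<And>j. j < dim_col G \<Longrightarrow> w j = (\<Sum>i<dim_row G. b i * G $$ (i, j))"
    by (metis in_row_spanE)
  thus ?thesis
    by (intro in_row_spanI[of _ _ "\<lambda>i. a i + b i"]) (simp add: distrib_right sum.distrib)
qed

lemma in_row_span_mult:
  assumes "in_row_span G w"
  shows "in_row_span G (\<lambda>j. c * w j)"
proof -
  from assms obtain a where "\<And>j. j < dim_col G \<Longrightarrow> w j = (\<Sum>i<dim_row G. a i * G $$ (i, j))"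
    by (metis in_row_spanE)
  thus ?thesis
    by (intro in_row_spanI[of _ _ "\<lambda>i. c * a i"]) (simp add: sum_distrib_left mult.assoc)
qed

lemma in_row_span_diff:
  assumes "in_row_span G v" "in_row_span G w"
  shows "in_row_span G (\<lambda>j. v j - w j)"
  using in_row_span_add[OF assms(1) in_row_span_mult[OF assms(2), of "-1"]] by simp

lemma in_row_span_mult_mat:
  assumes U: "U \<in> carrier_mat k l" and G: "G \<in> carrier_mat l n" and w: "in_row_span (U * G) w"
  shows "in_row_span G w"
proof -
  obtain a where a: "\<And>j. j < n \<Longrightarrow> w j = (\<Sum>i<k. a i * (U * G) $$ (i, j))"
    using in_row_spanE[OF w] U G by auto
  have "w j = (\<Sum>r<l. (\<Sum>i<k. a i * U $$ (i, r)) * G $$ (r, j))" if j: "j < n" for j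
  proof -
    have "w j = (\<Sum>i<k. \<Sum>r<l. a i * (U $$ (i, r) * G $$ (r, j)))"
      unfolding a[OF j] using U G j
      by (intro sum.cong refl) (simp add: scalar_prod_def sum_distrib_left atLeast0LessThan)
    also have "\<dots> = (\<Sum>r<l. \<Sum>i<k. a i * (U $$ (i, r) * G $$ (r, j)))" by (rule sum.swap)
    finally show ?thesis by (simp add: sum_distrib_right mult.assoc)
  qed
  thus ?thesis using G by (intro in_row_spanI[of _ _ "\<lambda>r. \<Sum>i<k. a i * U $$ (i, r)"]) auto
qed

text \<open>
  A state \<open>x\<close> records past inputs: its entry \<open>(i, a)\<close> is the \<open>i\<close>-th input of \<open>a + 1\<close> time steps
  ago. The polynomial vector \<open>state_map G x\<close> is the output produced from \<open>x\<close> by zero inputs.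
\<close>

definition state_map :: "'a::field poly mat \<Rightarrow> 'a vec \<Rightarrow> nat \<Rightarrow> 'a poly" where
  "state_map G x j = (\<Sum>i<dim_row G. \<Sum>a<row_degree G i.
     smult (x $ block_pos (row_degree G) i a) (poly_shift (Suc a) (G $$ (i, j))))"

lemma coeff_state_map:
  "coeff (state_map G x j) m = (\<Sum>i<dim_row G. \<Sum>a<row_degree G i.
     x $ block_pos (row_degree G) i a * coeff (G $$ (i, j)) (m + Suc a))"
  by (simp add: state_map_def coeff_sum coeff_poly_shift)

lemma state_map_add:
  assumes "G \<in> carrier_mat k n" "y \<in> carrier_vec (\<Sum>i<k. row_degree G i)"
  shows "state_map G (x + y) j = state_map G x j + state_map G y j"
  using assms by (simp add: state_map_def block_pos_less smult_add_left sum.distrib)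

lemma state_map_diff:
  assumes "G \<in> carrier_mat k n" "y \<in> carrier_vec (\<Sum>i<k. row_degree G i)"
  shows "state_map G (x - y) j = state_map G x j - state_map G y j"
  using assms by (simp add: state_map_def block_pos_less smult_diff_left sum_subtractf)

lemma state_map_smult:
  assumes "G \<in> carrier_mat k n" "x \<in> carrier_vec (\<Sum>i<k. row_degree G i)"
  shows "state_map G (c \<cdot>\<^sub>v x) j = smult c (state_map G x j)"
  using assms
  by (intro poly_eqI) (simp add: coeff_state_map block_pos_less sum_distrib_left mult.assoc)

lemma state_map_zero:
  assumes "G \<in> carrier_mat k n"
  shows "state_map G (0\<^sub>v (\<Sum>i<k. row_degree G i)) j = 0"
  using assms by (simp add: state_map_def block_pos_less)

text \<open>Shows that the shifted rows of \<open>G\<close> are themselves values of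
  \<open>state_map\<close>; they are the building blocks for comparing the states of two generator
  matrices.\<close>

lemma state_map_unit_vec:
  assumes G: "G \<in> carrier_mat k n" and i: "i < k" and a: "a < row_degree G i"
  shows "state_map G (unit_vec (\<Sum>i<k. row_degree G i) (block_pos (row_degree G) i a)) j =
    poly_shift (Suc a) (G $$ (i, j))"
proof -
  let ?e = "unit_vec (\<Sum>i<k. row_degree G i) (block_pos (row_degree G) i a)"
  have "?e $ block_pos (row_degree G) l b = (if l = i \<and> b = a then 1 else 0)"
    if "l < k" "b < row_degree G l" for l b
    using assms that block_pos_inject[of b "row_degree G" l a i] by (simp add: block_pos_less)
  note e = this
  have "state_map G ?e j = (\<Sum>l<k. \<Sum>b<row_degree G l.
      if l = i \<and> b = a then poly_shift (Suc a) (G $$ (i, j)) else 0)"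
    unfolding state_map_def carrier_matD(1)[OF G] by (intro sum.cong refl) (simp add: e)
  also have "\<dots> = (\<Sum>l<k. if l = i then poly_shift (Suc a) (G $$ (i, j)) else 0)"
    using a by (intro sum.cong refl) auto
  also have "\<dots> = poly_shift (Suc a) (G $$ (i, j))" using i by simp
  finally show ?thesis .
qed

text \<open>The negative powers of the input are made polynomial by a factor \<open>z ^ N\<close>.\<close>

definition past_input :: "'a::field poly mat \<Rightarrow> nat \<Rightarrow> 'a vec \<Rightarrow> nat \<Rightarrow> 'a poly" where
  "past_input G N x i =
     (\<Sum>a<row_degree G i. monom (x $ block_pos (row_degree G) i a) (N - Suc a))"

text \<open>The bound on \<open>N\<close> keeps all exponents \<open>N - Suc a\<close> free of
  truncation and hence distinct, so each coefficient shows at most one entry of the state.\<close>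

lemma coeff_past_input:
  assumes "row_degree G i \<le> N"
  shows "coeff (past_input G N x i) m =
    (if m < N \<and> N - Suc m < row_degree G i then x $ block_pos (row_degree G) i (N - Suc m) else 0)"
proof -
  have "coeff (past_input G N x i) m =
      (\<Sum>a<row_degree G i. if m < N \<and> a = N - Suc m then x $ block_pos (row_degree G) i a else 0)"
    unfolding past_input_def coeff_sum coeff_monom using assms by (intro sum.cong refl) auto
  also have "\<dots> = (if m < N then \<Sum>a<row_degree G i.
      if a = N - Suc m then x $ block_pos (row_degree G) i a else 0 else 0)" by simp
  also have "\<dots> = (if m < N \<and> N - Suc m < row_degree G i
      then x $ block_pos (row_degree G) i (N - Suc m) else 0)" by simp
  finally show ?thesis .
qed

text \<open>Feeding the past inputs into \<open>G\<close> and keeping only the nonnegative powers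
  gives the zero-input response. The factor \<open>z ^ N\<close> moves the cut from degree 0 to
  degree \<open>N\<close>.\<close>

lemma coeff_past_input_mult:
  assumes "G \<in> carrier_mat k n" "\<And>i. i < k \<Longrightarrow> row_degree G i \<le> N"
  shows "coeff (\<Sum>i<k. past_input G N x i * G $$ (i, j)) (N + m) = coeff (state_map G x j) m"
proof -
  have "coeff (monom c (N - Suc a) * p) (N + m) = c * coeff p (m + Suc a)"
    if "a < N" for c :: 'a and a p
    using that by (simp add: coeff_monom_mult)
  moreover have "a < N" if "a < row_degree G i" "i < k" for a i
    using assms(2)[OF that(2)] that(1) by simp
  ultimately show ?thesis using assms(1)
    by (auto simp: coeff_state_map past_input_def coeff_sum sum_distrib_right intro!: sum.cong)
qed

lemma row_degree_le_sum: "i < k \<Longrightarrow> row_degree G i \<le> (\<Sum>i<k. row_degree G i)"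
  by (intro member_le_sum) auto

text \<open>If the difference of the two responses is a row combination with coefficients
  \<open>a\<close>, then past input plus \<open>z ^ N * a\<close> produces output of degree below
  \<open>N\<close>. By the predictable degree property its \<open>i\<close>-th entry has no
  coefficient from \<open>N - row_degree G i\<close> on, and just below \<open>N\<close> these
  coefficients are the entries of the state.\<close>

lemma state_map_inj_mod_row_span:
  assumes G: "G \<in> carrier_mat k n" and red: "row_reduced G"
    and x: "x \<in> carrier_vec (\<Sum>i<k. row_degree G i)" and y: "y \<in> carrier_vec (\<Sum>i<k. row_degree G i)"
    and span: "in_row_span G (\<lambda>j. state_map G y j - state_map G x j)"
  shows "x = y"
proof -
  let ?N = "\<Sum>i<k. row_degree G i"
  define d where "d = x - y"
  have "state_map G d j = state_map G x j - state_map G y j" for j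
    unfolding d_def by (rule state_map_diff[OF G y])
  then obtain a where a: "\<And>j. j < n \<Longrightarrow> - state_map G d j = (\<Sum>i<k. a i * G $$ (i, j))"
    using in_row_spanE[OF span] G by auto
  have past: "coeff (\<Sum>i<k. past_input G ?N d i * G $$ (i, j)) (?N + r) = coeff (state_map G d j) r"
    for r j by (rule coeff_past_input_mult[OF G]) (rule row_degree_le_sum)
  have deg: "coeff (past_input G ?N d i + monom 1 ?N * a i) m = 0" if "i < k" "?N \<le> m + row_degree G i" for i m
  proof (rule row_reduced_coeff_eq_0[OF G red _ that])
    fix j m assume j: "j < n" and m: "?N \<le> m"
    have "coeff (\<Sum>i<k. monom 1 ?N * a i * G $$ (i, j)) m = coeff (monom 1 ?N * (- state_map G d j)) m"
      by (simp add: a[OF j] sum_distrib_left mult.assoc)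
    also have "\<dots> = - coeff (state_map G d j) (m - ?N)" using m by (simp add: coeff_monom_mult)
    also have "coeff (state_map G d j) (m - ?N) = coeff (\<Sum>i<k. past_input G ?N d i * G $$ (i, j)) m"
      using past[of j "m - ?N"] m by simp
    finally show "coeff (\<Sum>i<k. (past_input G ?N d i + monom 1 ?N * a i) * G $$ (i, j)) m = 0"
      by (simp add: distrib_right sum.distrib)
  qed
  have zero: "d $ block_pos (row_degree G) i b = 0" if i: "i < k" and b: "b < row_degree G i" for i b
  proof -
    have le: "row_degree G i \<le> ?N" by (rule row_degree_le_sum[OF i])
    \<comment> \<open>At the exponent \<open>?N - Suc b\<close> the summand
      \<open>monom 1 ?N * a i\<close> contributes nothing, which leaves entry \<open>b\<close>
      alone.\<close>
    with b have "?N - Suc b < ?N" "?N - Suc (?N - Suc b) = b" by linarith+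
    with deg[OF i, of "?N - Suc b"] le b show ?thesis
      by (simp add: coeff_past_input coeff_monom_mult)
  qed
  show "x = y"
  proof (rule eq_vecI)
    fix r assume "r < dim_vec y"
    hence "r < ?N" using y by simp
    then obtain i b where "i < k" "b < row_degree G i" "r = block_pos (row_degree G) i b"
      by (rule block_pos_exhaust)
    with zero[of i b] have "d $ r = 0" by simp
    thus "x $ r = y $ r" using x y \<open>r < ?N\<close> by (simp add: d_def)
  qed (use x y in simp)
qed


section \<open>Transitions of the controller canonical form\<close>

lemma row_mult_index:
  assumes "dim_vec u = dim_row A" "j < dim_col A"
  shows "row_mult u A $ j = (\<Sum>r<dim_row A. u $ r * A $$ (r, j))"
  using assms by (auto simp: row_mult_def scalar_prod_def atLeast0LessThan mult.commute intro!: sum.cong)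

lemma dim_row_mult [simp]: "dim_vec (row_mult u A) = dim_col A"
  by (simp add: row_mult_def)

section \<open>Dimensions and entries of the four matrices at block positions\<close>

lemma ccf_A_carrier:
  assumes "G \<in> carrier_mat k n"
  shows "ccf_A G \<in> carrier_mat (\<Sum>i<k. row_degree G i) (\<Sum>i<k. row_degree G i)"
  using assms by (intro carrier_matI)
    (simp_all add: ccf_A_def dim_diag_block_mat comp_def ccf_A_block_def
      interv_sum_list_conv_sum_set_nat atLeast0LessThan)

lemma ccf_B_carrier:
  assumes "G \<in> carrier_mat k n"
  shows "ccf_B G \<in> carrier_mat k (\<Sum>i<k. row_degree G i)"
  using assms by (intro carrier_matI)
    (simp_all add: ccf_B_def dim_diag_block_mat comp_def ccf_B_block_def
      interv_sum_list_conv_sum_set_nat atLeast0LessThan)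

lemma ccf_C_carrier:
  assumes "G \<in> carrier_mat k n"
  shows "ccf_C G \<in> carrier_mat (\<Sum>i<k. row_degree G i) n"
  using assms by (intro carrier_matI)
    (simp_all add: ccf_C_def length_concat comp_def interv_sum_list_conv_sum_set_nat atLeast0LessThan
      del: upt_Suc)

lemma ccf_D_carrier: "G \<in> carrier_mat k n \<Longrightarrow> ccf_D G \<in> carrier_mat k n"
  by (simp add: ccf_D_def)

lemma ccf_A_index:
  assumes "G \<in> carrier_mat k n" "i < k" "l < k" "a < row_degree G i" "b < row_degree G l"
  shows "ccf_A G $$ (block_pos (row_degree G) i a, block_pos (row_degree G) l b) =
    (if i = l \<and> b = Suc a then 1 else 0)"
  using diag_block_mat_index[of i k l a "ccf_A_block G" b] assms
  by (auto simp: ccf_A_def ccf_A_block_def)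

lemma ccf_B_index:
  assumes "G \<in> carrier_mat k n" "i < k" "l < k" "b < row_degree G l"
  shows "ccf_B G $$ (i, block_pos (row_degree G) l b) = (if i = l \<and> b = 0 then 1 else 0)"
  \<comment> \<open>Every block of \<open>ccf_B\<close> has a single row, so the row position of
    block \<open>i\<close> is \<open>i\<close> itself.\<close>
  using diag_block_mat_index[of i k l 0 "ccf_B_block G" b] assms
  by (simp add: ccf_B_def ccf_B_block_def block_pos_def[of "\<lambda>_. Suc 0"])

lemma ccf_C_index:
  assumes "G \<in> carrier_mat k n" "i < k" "a < row_degree G i" "j < n"
  shows "ccf_C G $$ (block_pos (row_degree G) i a, j) = coeff (G $$ (i, j)) (Suc a)"
proof -
  let ?F = "\<lambda>i. map (coeff_row G i) [1..<Suc (row_degree G i)]"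
  have "block_pos (row_degree G) i a < dim_row (ccf_C G)"
    using ccf_C_carrier[OF assms(1)] block_pos_less[of i k a "row_degree G"] assms by simp
  hence "ccf_C G $$ (block_pos (row_degree G) i a, j) =
      concat (map ?F [0..<k]) ! block_pos (row_degree G) i a $ j"
    using assms by (simp add: ccf_C_def mat_of_rows_def)
  also have "concat (map ?F [0..<k]) ! block_pos (row_degree G) i a = ?F i ! a"
    using nth_concat_block_pos[of i k a ?F] assms by (simp del: upt_Suc)
  also have "?F i ! a = coeff_row G i (Suc a)" using assms by (simp del: upt_Suc)
  finally show ?thesis using assms by (simp add: coeff_row_def)
qed

text \<open>Each block acts as a shift register: \<open>ccf_B\<close> writes the new input at offset
  0 and \<open>ccf_A\<close> moves every older input one place on.\<close>

lemma next_state_index: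
  assumes G: "G \<in> carrier_mat k n"
    and x: "x \<in> carrier_vec (\<Sum>i<k. row_degree G i)" and u: "u \<in> carrier_vec k"
    and l: "l < k" and b: "b < row_degree G l"
  shows "(row_mult x (ccf_A G) + row_mult u (ccf_B G)) $ block_pos (row_degree G) l b =
    (case b of 0 \<Rightarrow> u $ l | Suc c \<Rightarrow> x $ block_pos (row_degree G) l c)"
proof -
  note less = block_pos_less[of l k b "row_degree G", OF l b]
  let ?p = "block_pos (row_degree G)"
  have "row_mult x (ccf_A G) $ ?p l b =
      (\<Sum>i<k. \<Sum>a<row_degree G i. if i = l \<and> b = Suc a then x $ ?p i a else 0)"
    using ccf_A_carrier[OF G] x less
    by (auto simp: row_mult_index sum_block_pos ccf_A_index[OF G _ l _ b] intro!: sum.cong)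
  also have "\<dots> = (\<Sum>i<k. if i = l then \<Sum>a<row_degree G i. if b = Suc a then x $ ?p i a else 0 else 0)"
    by (intro sum.cong refl) auto
  also have "\<dots> = (\<Sum>a<row_degree G l. if b = Suc a then x $ ?p l a else 0)"
    using l by simp
  also have "\<dots> = (case b of 0 \<Rightarrow> 0 | Suc c \<Rightarrow> x $ ?p l c)"
    using b by (auto split: nat.splits)
  finally have 1: "row_mult x (ccf_A G) $ ?p l b = (case b of 0 \<Rightarrow> 0 | Suc c \<Rightarrow> x $ ?p l c)" .
  have "row_mult u (ccf_B G) $ ?p l b = (\<Sum>i<k. u $ i * (if i = l \<and> b = 0 then 1 else 0))"
    using ccf_B_carrier[OF G] u less by (simp add: row_mult_index ccf_B_index[OF G _ l b])
  also have "\<dots> = (if b = 0 then u $ l else 0)" using l by (simp add: mult_delta_right)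
  finally show ?thesis
    using 1 less ccf_B_carrier[OF G] ccf_A_carrier[OF G] by (auto split: nat.splits)
qed

lemma output_index:
  assumes G: "G \<in> carrier_mat k n"
    and x: "x \<in> carrier_vec (\<Sum>i<k. row_degree G i)" and u: "u \<in> carrier_vec k" and j: "j < n"
  shows "(row_mult x (ccf_C G) + row_mult u (ccf_D G)) $ j =
    coeff (state_map G x j) 0 + (\<Sum>i<k. u $ i * coeff (G $$ (i, j)) 0)"
proof -
  have "row_mult x (ccf_C G) $ j = coeff (state_map G x j) 0"
    using ccf_C_carrier[OF G] x j G
    by (auto simp: row_mult_index sum_block_pos ccf_C_index coeff_state_map intro!: sum.cong)
  moreover have "row_mult u (ccf_D G) $ j = (\<Sum>i<k. u $ i * coeff (G $$ (i, j)) 0)"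
    using ccf_D_carrier[OF G] u j G by (simp add: row_mult_index ccf_D_def)
  ultimately show ?thesis using ccf_D_carrier[OF G] j by simp
qed

text \<open>One step of the encoder in polynomial form: output plus \<open>z\<close> times the
  response of the next state equals the response of the current state plus the input times
  \<open>G\<close>.\<close>

lemma transition_state_map:
  assumes G: "G \<in> carrier_mat k n"
    and x: "x \<in> carrier_vec (\<Sum>i<k. row_degree G i)" and u: "u \<in> carrier_vec k" and j: "j < n"
  shows "pCons ((row_mult x (ccf_C G) + row_mult u (ccf_D G)) $ j)
      (state_map G (row_mult x (ccf_A G) + row_mult u (ccf_B G)) j) =
    state_map G x j + (\<Sum>i<k. [:u $ i:] * G $$ (i, j))" (is "pCons _ (state_map G ?y j) = _")
proof (rule poly_eqI)
  fix m
  let ?p = "block_pos (row_degree G)"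
  show "coeff (pCons ((row_mult x (ccf_C G) + row_mult u (ccf_D G)) $ j) (state_map G ?y j)) m =
    coeff (state_map G x j + (\<Sum>i<k. [:u $ i:] * G $$ (i, j))) m"
  proof (cases m)
    case 0
    then show ?thesis using output_index[OF assms] by (simp add: coeff_sum)
  next
    case (Suc m)
    have "(\<Sum>a<row_degree G i. ?y $ ?p i a * coeff (G $$ (i, j)) (m + Suc a)) =
        (\<Sum>a<row_degree G i. x $ ?p i a * coeff (G $$ (i, j)) (Suc m + Suc a)) +
          u $ i * coeff (G $$ (i, j)) (Suc m)" if i: "i < k" for i
    proof -
      have "(\<Sum>a<row_degree G i. ?y $ ?p i a * coeff (G $$ (i, j)) (m + Suc a)) =
          (\<Sum>a<row_degree G i. (case a of 0 \<Rightarrow> u $ i | Suc c \<Rightarrow> x $ ?p i c) * coeff (G $$ (i, j)) (m + Suc a))"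
        using next_state_index[OF G x u i] by (intro sum.cong refl) simp
      \<comment> \<open>The added term carries a coefficient above the row degree and is 0. With it
        the index shift can split off the new input without losing the oldest one.\<close>
      also have "\<dots> = (\<Sum>a<Suc (row_degree G i).
          (case a of 0 \<Rightarrow> u $ i | Suc c \<Rightarrow> x $ ?p i c) * coeff (G $$ (i, j)) (m + Suc a))"
        using coeff_above_row_degree[of j G i "m + Suc (row_degree G i)"] G j by simp
      also have "\<dots> = u $ i * coeff (G $$ (i, j)) (Suc m) +
          (\<Sum>a<row_degree G i. x $ ?p i a * coeff (G $$ (i, j)) (Suc m + Suc a))"
        by (simp add: sum.lessThan_Suc_shift del: sum.lessThan_Suc)
      finally show ?thesis by (simp only: add.commute)
    qed
    thus ?thesis using Suc G by (simp add: coeff_state_map coeff_sum sum.distrib)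
  qed
qed

text \<open>The combination \<open>a\<close> is recovered as a constant input. Applying the
  predictable degree property to the past of \<open>x\<close>, followed by \<open>a\<close>, minus
  \<open>z\<close> times the past of \<open>y\<close> forces \<open>a\<close> to be constant and
  \<open>y\<close> to be the shifted register.\<close>

lemma transition_of_row_span:
  assumes G: "G \<in> carrier_mat k n" and red: "row_reduced G"
    and x: "x \<in> carrier_vec (\<Sum>i<k. row_degree G i)" and y: "y \<in> carrier_vec (\<Sum>i<k. row_degree G i)"
    and v: "v \<in> carrier_vec n"
    and span: "in_row_span G (\<lambda>j. pCons (v $ j) (state_map G y j) - state_map G x j)"
  shows "\<exists>u\<in>carrier_vec k. y = row_mult x (ccf_A G) + row_mult u (ccf_B G) \<and>
    v = row_mult x (ccf_C G) + row_mult u (ccf_D G)"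
proof -
  let ?N = "\<Sum>i<k. row_degree G i"
  let ?p = "block_pos (row_degree G)"
  obtain a where a: "\<And>j. j < n \<Longrightarrow>
      pCons (v $ j) (state_map G y j) - state_map G x j = (\<Sum>i<k. a i * G $$ (i, j))"
    using in_row_spanE[OF span] G by auto
  define u where "u = vec k (\<lambda>i. coeff (a i) 0)"
  have u: "u \<in> carrier_vec k" by (simp add: u_def)
  \<comment> \<open>The coefficients of \<open>c i\<close> above \<open>?N\<close> will yield that
    \<open>a i\<close> is constant, the one at \<open>?N\<close> the entry of \<open>y\<close> at
    offset 0, and those just below the remaining entries of \<open>y\<close>.\<close>
  define c where "c i = past_input G ?N x i + monom 1 ?N * a i - monom 1 1 * past_input G ?N y i" for i
  have c: "coeff (c i) m = 0" if "i < k" "Suc ?N \<le> m + row_degree G i" for i m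
  proof (rule row_reduced_coeff_eq_0[OF G red _ that])
    fix j m assume j: "j < n" and "Suc ?N \<le> m"
    then obtain r where m: "m = Suc (?N + r)" by (auto dest: le_Suc_ex)
    have past: "coeff (\<Sum>i<k. past_input G ?N z i * G $$ (i, j)) (?N + r) = coeff (state_map G z j) r"
      for z r by (rule coeff_past_input_mult[OF G]) (rule row_degree_le_sum)
    have "(\<Sum>i<k. c i * G $$ (i, j)) = (\<Sum>i<k. past_input G ?N x i * G $$ (i, j)) +
        monom 1 ?N * (\<Sum>i<k. a i * G $$ (i, j)) -
        monom 1 1 * (\<Sum>i<k. past_input G ?N y i * G $$ (i, j))"
      by (simp add: c_def sum_distrib_left sum.distrib sum_subtractf algebra_simps)
    also have "coeff \<dots> m = coeff (state_map G x j) (Suc r) +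
        coeff (pCons (v $ j) (state_map G y j) - state_map G x j) (Suc r) - coeff (state_map G y j) r"
      using past[of x "Suc r"] past[of y r] by (simp add: m coeff_monom_mult a[OF j])
    also have "\<dots> = 0" by simp
    finally show "coeff (\<Sum>i<k. c i * G $$ (i, j)) m = 0" .
  qed
  have coeff_c: "coeff (c i) m = coeff (past_input G ?N x i) m + (if m < ?N then 0 else coeff (a i) (m - ?N)) -
      (if m = 0 then 0 else coeff (past_input G ?N y i) (m - 1))" for i m
    by (simp add: c_def coeff_monom_mult)
  have aconst: "a i = [:u $ i:]" if i: "i < k" for i
  proof (rule poly_eqI)
    fix m
    show "coeff (a i) m = coeff [:u $ i:] m"
      using c[OF i, of "?N + m"] row_degree_le_sum[OF i, of G] i
      by (cases m) (auto simp: u_def coeff_c coeff_past_input)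
  qed
  have yeq: "y = row_mult x (ccf_A G) + row_mult u (ccf_B G)"
  proof (rule eq_vecI)
    fix r assume "r < dim_vec (row_mult x (ccf_A G) + row_mult u (ccf_B G))"
    hence "r < ?N" using ccf_B_carrier[OF G] by simp
    then obtain i b where ib: "i < k" "b < row_degree G i" "r = ?p i b"
      by (rule block_pos_exhaust)
    have le: "row_degree G i \<le> ?N" using row_degree_le_sum[OF ib(1)] .
    have "y $ ?p i b = (case b of 0 \<Rightarrow> u $ i | Suc e \<Rightarrow> x $ ?p i e)"
    proof (cases b)
      case 0
      \<comment> \<open>Excludes the branch \<open>m = 0\<close> of \<open>coeff_c\<close>, in which
        the entry of \<open>y\<close> would not appear.\<close>
      moreover have "?N \<noteq> 0" using ib le by linarith
      ultimately show ?thesis using c[OF ib(1), of ?N] ib le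
        by (simp add: coeff_c coeff_past_input u_def del: sum_eq_0_iff)
    next
      case (Suc e)
      then show ?thesis using c[OF ib(1), of "?N - b"] ib le
        by (simp add: coeff_c coeff_past_input)
    qed
    thus "y $ r = (row_mult x (ccf_A G) + row_mult u (ccf_B G)) $ r"
      using next_state_index[OF G x u ib(1,2)] ib by simp
  qed (use y ccf_B_carrier[OF G] in simp)
  have "v = row_mult x (ccf_C G) + row_mult u (ccf_D G)"
  proof (rule eq_vecI)
    fix j assume "j < dim_vec (row_mult x (ccf_C G) + row_mult u (ccf_D G))"
    hence j: "j < n" using ccf_D_carrier[OF G] by simp
    have "pCons (v $ j) (state_map G y j) = state_map G x j + (\<Sum>i<k. [:u $ i:] * G $$ (i, j))"
      using a[OF j] aconst by (simp add: algebra_simps)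
    also have "\<dots> = pCons ((row_mult x (ccf_C G) + row_mult u (ccf_D G)) $ j) (state_map G y j)"
      unfolding yeq by (rule transition_state_map[OF G x u j, symmetric])
    finally show "v $ j = (row_mult x (ccf_C G) + row_mult u (ccf_D G)) $ j" by simp
  qed (use v ccf_D_carrier[OF G] in simp)
  with u yeq show ?thesis by blast
qed

section \<open>Counting transitions by their outputs\<close>

definition input_count :: "'a::{field, finite} poly mat \<Rightarrow> 'a vec \<Rightarrow> 'a vec \<Rightarrow> nat \<Rightarrow> nat" where
  "input_count G x y \<alpha> = card {u \<in> carrier_vec (dim_row G).
     y = row_mult x (ccf_A G) + row_mult u (ccf_B G) \<and>
     hamming_weight (row_mult x (ccf_C G) + row_mult u (ccf_D G)) = \<alpha>}"

text \<open>For fixed states, two inputs with equal output differ by a constant combination of rows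
  equal to 0, hence agree. Counting outputs instead of inputs leaves a condition that involves only
  the row module and the responses.\<close>

lemma input_count_eq_output_count:
  fixes G :: "'a::{field, finite} poly mat"
  assumes G: "G \<in> carrier_mat k n" and red: "row_reduced G"
    and x: "x \<in> carrier_vec (\<Sum>i<k. row_degree G i)" and y: "y \<in> carrier_vec (\<Sum>i<k. row_degree G i)"
  shows "input_count G x y \<alpha> = card {v \<in> carrier_vec n. hamming_weight v = \<alpha> \<and>
      in_row_span G (\<lambda>j. pCons (v $ j) (state_map G y j) - state_map G x j)}"
    (is "_ = card ?V")
proof -
  let ?U = "{u \<in> carrier_vec k. y = row_mult x (ccf_A G) + row_mult u (ccf_B G) \<and>
      hamming_weight (row_mult x (ccf_C G) + row_mult u (ccf_D G)) = \<alpha>}"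
  let ?f = "\<lambda>u. row_mult x (ccf_C G) + row_mult u (ccf_D G)"
  have "inj_on ?f ?U"
  proof (rule inj_onI)
    fix u u' assume uU: "u \<in> ?U" and u'U: "u' \<in> ?U" and f: "?f u = ?f u'"
    hence u: "u \<in> carrier_vec k" and u': "u' \<in> carrier_vec k" by auto
    have "(\<Sum>i<k. ([:u $ i:] - [:u' $ i:]) * G $$ (i, j)) = 0" if j: "j < n" for j
    proof -
      have "state_map G x j + (\<Sum>i<k. [:u $ i:] * G $$ (i, j)) =
          state_map G x j + (\<Sum>i<k. [:u' $ i:] * G $$ (i, j))"
        using transition_state_map[OF G x u j] transition_state_map[OF G x u' j] uU u'U f by auto
      thus ?thesis by (simp only: left_diff_distrib sum_subtractf add_left_cancel diff_self)
    qed
    \<comment> \<open>With \<open>D = 0\<close> the predictable degree property is the linear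
      independence of the rows of \<open>G\<close>.\<close>
    hence "coeff ([:u $ i:] - [:u' $ i:]) 0 = 0" if "i < k" for i
      using that
      by (intro row_reduced_coeff_eq_0[OF G red, where D = 0 and p = "\<lambda>i. [:u $ i:] - [:u' $ i:]"])
        (simp_all only: coeff_0 le0)
    thus "u = u'" using u u' by (intro eq_vecI) auto
  qed
  moreover have "?f ` ?U = ?V"
  proof (intro equalityI subsetI)
    fix v assume "v \<in> ?f ` ?U"
    then obtain u where u: "u \<in> ?U" and v: "v = ?f u" by blast
    hence uc: "u \<in> carrier_vec k" by simp
    have "v \<in> carrier_vec n" unfolding v using ccf_D_carrier[OF G] by (intro carrier_vecI) simp
    moreover have "in_row_span G (\<lambda>j. pCons (v $ j) (state_map G y j) - state_map G x j)"
      using transition_state_map[OF G x uc] u G unfolding v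
      by (intro in_row_spanI[of _ _ "\<lambda>i. [:u $ i:]"]) (auto simp del: mult_pCons_left)
    ultimately show "v \<in> ?V" using u v by auto
  next
    fix v assume "v \<in> ?V"
    with transition_of_row_span[OF G red x y, of v] show "v \<in> ?f ` ?U" by auto
  qed
  ultimately have "bij_betw ?f ?U ?V" by (simp add: bij_betw_def)
  thus ?thesis using G by (simp add: input_count_def bij_betw_same_card)
qed


section \<open>Independence of the generator matrix\<close>

text \<open>The preimage, among polynomial vectors, of the set of state classes modulo the row
  module. It is closed under sums and under scalars from the field.\<close>

definition congruent_to_state :: "'a::field poly mat \<Rightarrow> (nat \<Rightarrow> 'a poly) \<Rightarrow> bool" where
  "congruent_to_state G w \<longleftrightarrow> (\<exists>x\<in>carrier_vec (\<Sum>i<dim_row G. row_degree G i).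
     in_row_span G (\<lambda>j. w j - state_map G x j))"

lemma in_row_span_cong:
  assumes "\<And>j. j < dim_col G \<Longrightarrow> v j = w j"
  shows "in_row_span G v \<longleftrightarrow> in_row_span G w"
  using assms by (simp add: in_row_span_def)

lemma congruent_to_state_cong:
  assumes "\<And>j. j < dim_col G \<Longrightarrow> v j = w j"
  shows "congruent_to_state G v \<longleftrightarrow> congruent_to_state G w"
proof -
  have "in_row_span G (\<lambda>j. v j - state_map G x j) \<longleftrightarrow> in_row_span G (\<lambda>j. w j - state_map G x j)" for x
    by (intro in_row_span_cong) (simp add: assms)
  thus ?thesis by (simp add: congruent_to_state_def)
qed

lemma congruent_to_state_add:
  assumes "congruent_to_state G v" "congruent_to_state G w"
  shows "congruent_to_state G (\<lambda>j. v j + w j)"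
proof -
  let ?N = "\<Sum>i<dim_row G. row_degree G i"
  have G: "G \<in> carrier_mat (dim_row G) (dim_col G)" by simp
  from assms obtain x y where x: "x \<in> carrier_vec ?N" "in_row_span G (\<lambda>j. v j - state_map G x j)"
    and y: "y \<in> carrier_vec ?N" "in_row_span G (\<lambda>j. w j - state_map G y j)"
    by (auto simp: congruent_to_state_def)
  have "in_row_span G (\<lambda>j. v j + w j - state_map G (x + y) j)"
    using in_row_span_add[OF x(2) y(2)] state_map_add[OF G y(1), of x] by (simp add: algebra_simps)
  thus ?thesis using x y by (auto simp: congruent_to_state_def intro!: bexI[of _ "x + y"])
qed

lemma congruent_to_state_smult:
  assumes "congruent_to_state G w"
  shows "congruent_to_state G (\<lambda>j. smult c (w j))"
proof -
  let ?N = "\<Sum>i<dim_row G. row_degree G i"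
  have G: "G \<in> carrier_mat (dim_row G) (dim_col G)" by simp
  from assms obtain x where x: "x \<in> carrier_vec ?N" "in_row_span G (\<lambda>j. w j - state_map G x j)"
    by (auto simp: congruent_to_state_def)
  have "in_row_span G (\<lambda>j. smult c (w j) - state_map G (c \<cdot>\<^sub>v x) j)"
    using in_row_span_mult[OF x(2), of "[:c:]"] state_map_smult[OF G x(1), of c]
    by (simp add: smult_diff_right)
  thus ?thesis using x by (auto simp: congruent_to_state_def intro!: bexI[of _ "c \<cdot>\<^sub>v x"])
qed

lemma congruent_to_state_span:
  assumes "in_row_span G w"
  shows "congruent_to_state G w"
  unfolding congruent_to_state_def
  using assms state_map_zero[of G "dim_row G" "dim_col G"]
  by (intro bexI[of _ "0\<^sub>v (\<Sum>i<dim_row G. row_degree G i)"]) auto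

lemma congruent_to_state_sum:
  assumes "\<And>i. i \<in> I \<Longrightarrow> congruent_to_state G (w i)"
  shows "congruent_to_state G (\<lambda>j. \<Sum>i\<in>I. w i j)"
proof -
  have "congruent_to_state G (\<lambda>j. 0)"
    by (intro congruent_to_state_span in_row_spanI[of _ _ "\<lambda>_. 0"]) simp
  thus ?thesis using assms
    by (induction I rule: infinite_finite_induct) (auto intro: congruent_to_state_add)
qed

lemma congruent_to_state_mult_row:
  assumes "i < dim_row G"
  shows "congruent_to_state G (\<lambda>j. p * G $$ (i, j))"
proof -
  have "p * g i = (\<Sum>l<dim_row G. (if l = i then p else 0) * g l)" for g
    using assms by (simp add: mult_delta_left)
  thus ?thesis by (intro congruent_to_state_span in_row_spanI[of _ _ "\<lambda>l. if l = i then p else 0"])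
qed

text \<open>Shifts up to the row degree come from unit vectors; any larger shift annihilates the
  row.\<close>

lemma congruent_to_state_shift_row:
  assumes i: "i < dim_row G"
  shows "congruent_to_state G (\<lambda>j. poly_shift (Suc a) (G $$ (i, j)))"
proof (cases "a < row_degree G i")
  case True
  let ?N = "\<Sum>i<dim_row G. row_degree G i"
  have G: "G \<in> carrier_mat (dim_row G) (dim_col G)" by simp
  have "in_row_span G (\<lambda>j. 0)" by (intro in_row_spanI[of _ _ "\<lambda>_. 0"]) simp
  thus ?thesis unfolding congruent_to_state_def
    by (intro bexI[of _ "unit_vec ?N (block_pos (row_degree G) i a)"])
      (simp_all add: state_map_unit_vec[OF G i True])
next
  case False
  have "poly_shift (Suc a) (G $$ (i, j)) = 0 * G $$ (i, j)" if "j < dim_col G" for j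
    using False by (intro poly_eqI) (simp add: coeff_poly_shift coeff_above_row_degree[OF that])
  with congruent_to_state_mult_row[OF i, of 0] show ?thesis
    by (subst congruent_to_state_cong) auto
qed

text \<open>Low coefficients of \<open>p\<close> use up only part of the shift and pass the rest on
  to \<open>q\<close>; the high part of \<open>p\<close> absorbs it all and leaves a multiple of
  \<open>q\<close>. This splits a shifted row of \<open>U * G\<close> into shifted rows of
  \<open>G\<close> and elements of its row module.\<close>

lemma poly_shift_mult:
  fixes p q :: "'a::comm_semiring_1 poly"
  shows "poly_shift s (p * q) =
    (\<Sum>b<s. smult (coeff p b) (poly_shift (s - b) q)) + poly_shift s p * q"
proof (rule poly_eqI)
  fix m
  have "coeff (poly_shift s (p * q)) m = (\<Sum>i<s + Suc m. coeff p i * coeff q (m + s - i))"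
    by (simp add: coeff_poly_shift coeff_mult lessThan_Suc_atMost add.commute)
  also have "\<dots> = (\<Sum>i<s. coeff p i * coeff q (m + s - i)) + (\<Sum>i<Suc m. coeff p (s + i) * coeff q (m - i))"
    by (simp only: sum_lessThan_add) (simp add: add.commute)
  also have "\<dots> = coeff ((\<Sum>b<s. smult (coeff p b) (poly_shift (s - b) q)) + poly_shift s p * q) m"
    by (simp add: coeff_sum coeff_poly_shift coeff_mult lessThan_Suc_atMost add.commute)
  finally show "coeff (poly_shift s (p * q)) m =
    coeff ((\<Sum>b<s. smult (coeff p b) (poly_shift (s - b) q)) + poly_shift s p * q) m" .
qed

lemma congruent_to_state_state_map:
  assumes U: "U \<in> carrier_mat l k" and G: "G \<in> carrier_mat k n"
  shows "congruent_to_state G (state_map (U * G) x)"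
proof -
  let ?c = "\<lambda>i a. x $ block_pos (row_degree (U * G)) i a"
  let ?w = "\<lambda>i a r j. (\<Sum>b<Suc a. smult (coeff (U $$ (i, r)) b) (poly_shift (Suc a - b) (G $$ (r, j)))) +
      poly_shift (Suc a) (U $$ (i, r)) * G $$ (r, j)"
  have "state_map (U * G) x j = (\<Sum>i<l. \<Sum>a<row_degree (U * G) i. smult (?c i a) (\<Sum>r<k. ?w i a r j))"
    if j: "j < n" for j
  proof -
    have "poly_shift (Suc a) ((U * G) $$ (i, j)) = (\<Sum>r<k. ?w i a r j)" if "i < l" for i a
    proof -
      have "(U * G) $$ (i, j) = (\<Sum>r<k. U $$ (i, r) * G $$ (r, j))"
        using U G that j by (simp add: scalar_prod_def atLeast0LessThan)
      moreover have "poly_shift s (\<Sum>r<k. f r) = (\<Sum>r<k. poly_shift s (f r))" for s and f :: "nat \<Rightarrow> 'a poly"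
        by (intro poly_eqI) (simp add: coeff_poly_shift coeff_sum)
      ultimately show ?thesis by (simp only: poly_shift_mult)
    qed
    thus ?thesis using U by (simp add: state_map_def)
  qed
  moreover have "congruent_to_state G
      (\<lambda>j. \<Sum>i<l. \<Sum>a<row_degree (U * G) i. smult (?c i a) (\<Sum>r<k. ?w i a r j))"
  proof (intro congruent_to_state_sum congruent_to_state_smult congruent_to_state_add)
    fix r assume "r \<in> {..<k}"
    hence r: "r < dim_row G" using G by simp
    show "congruent_to_state G (\<lambda>j. p * G $$ (r, j))" for p
      by (rule congruent_to_state_mult_row[OF r])
    show "congruent_to_state G (\<lambda>j. poly_shift (Suc a - b) (G $$ (r, j)))" if "b \<in> {..<Suc a}" for a b
      \<comment> \<open>Since \<open>b\<close> is at most \<open>a\<close>, the remaining shift is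
        positive and has the form \<open>Suc (a - b)\<close>.\<close>
      using congruent_to_state_shift_row[OF r, of "a - b"] that by (simp add: Suc_diff_le)
  qed
  ultimately show ?thesis using G by (subst congruent_to_state_cong) auto
qed

section \<open>Matching the states of two generator matrices of one code\<close>

lemma in_row_span_transfer:
  assumes "generator_matrix k n \<C> G" "generator_matrix k n \<C> G'" "in_row_span G w"
  shows "in_row_span G' w"
proof -
  obtain U where "U \<in> carrier_mat k k" "G = U * G'"
    using generator_matrix_transition[OF assms(2,1)] by blast
  moreover have "G' \<in> carrier_mat k n"
    using assms(2) by (simp add: generator_matrix_def basic_mat_def)
  ultimately show ?thesis using assms(3) in_row_span_mult_mat by blast
qed

lemma finite_carrier_vec: "finite (carrier_vec n :: 'a::finite vec set)"
proof -
  have "(carrier_vec n :: 'a vec set) \<subseteq> vec_of_list ` {xs. set xs \<subseteq> UNIV \<and> length xs = n}"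
  proof
    fix v :: "'a vec" assume "v \<in> carrier_vec n"
    thus "v \<in> vec_of_list ` {xs. set xs \<subseteq> UNIV \<and> length xs = n}"
      by (intro image_eqI[of _ _ "list_of_vec v"]) (auto simp: vec_list)
  qed
  thus ?thesis by (rule finite_subset) (intro finite_imageI finite_lists_length_eq finite)
qed

lemma state_bijection:
  fixes G G' :: "'a::{field, finite} poly mat"
  assumes G: "minimal_generator_matrix k n \<C> G" and G': "minimal_generator_matrix k n \<C> G'"
    and \<gamma>: "\<gamma> = overall_constraint_length k n \<C>" "\<gamma> > 0"
  obtains \<phi> where "bij_betw \<phi> (carrier_vec \<gamma>) (carrier_vec \<gamma>)" "\<phi> (0\<^sub>v \<gamma>) = 0\<^sub>v \<gamma>"
    "\<And>x y \<alpha>. x \<in> carrier_vec \<gamma> \<Longrightarrow> y \<in> carrier_vec \<gamma> \<Longrightarrow>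
      input_count G' x y \<alpha> = input_count G (\<phi> x) (\<phi> y) \<alpha>"
proof -
  have gen: "generator_matrix k n \<C> G" "generator_matrix k n \<C> G'"
    using G G' by (simp_all add: minimal_generator_matrix_def)
  hence c: "G \<in> carrier_mat k n" "G' \<in> carrier_mat k n"
    by (simp_all add: generator_matrix_def basic_mat_def)
  have red: "row_reduced G" "row_reduced G'"
    using minimal_generator_matrix_row_reduced G G' \<gamma> by blast+
  have deg: "(\<Sum>i<k. row_degree G i) = \<gamma>" "(\<Sum>i<k. row_degree G' i) = \<gamma>"
    using G G' \<gamma> by (simp_all add: minimal_generator_matrix_def)
  have span: "in_row_span G' w \<longleftrightarrow> in_row_span G w" for w
    using in_row_span_transfer[OF gen] in_row_span_transfer[OF gen(2,1)] by blast
  obtain U where U: "U \<in> carrier_mat k k" "G' = U * G"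
    using generator_matrix_transition[OF gen] by blast
  have "\<exists>y\<in>carrier_vec \<gamma>. in_row_span G (\<lambda>j. state_map G' x j - state_map G y j)" for x
    using congruent_to_state_state_map[OF U(1) c(1), of x] c(1) deg(1)
    by (simp add: congruent_to_state_def U(2))
  then obtain \<phi> where \<phi>: "\<And>x. \<phi> x \<in> carrier_vec \<gamma>"
    "\<And>x. in_row_span G (\<lambda>j. state_map G' x j - state_map G (\<phi> x) j)" by metis
  have inj: "inj_on \<phi> (carrier_vec \<gamma>)"
  proof (rule inj_onI)
    fix x y assume xy: "x \<in> carrier_vec \<gamma>" "y \<in> carrier_vec \<gamma>" "\<phi> x = \<phi> y"
    have "in_row_span G' (\<lambda>j. state_map G' y j - state_map G' x j)"
      unfolding span using in_row_span_diff[OF \<phi>(2)[of y] \<phi>(2)[of x]] xy(3) by simp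
    thus "x = y" using state_map_inj_mod_row_span[OF c(2) red(2)] xy deg by simp
  qed
  \<comment> \<open>Surjectivity comes from finiteness: both encoders have the same state
    space.\<close>
  have "\<phi> ` carrier_vec \<gamma> = carrier_vec \<gamma>"
    using \<phi>(1) inj by (intro endo_inj_surj finite_carrier_vec) auto
  with inj have bij: "bij_betw \<phi> (carrier_vec \<gamma>) (carrier_vec \<gamma>)" by (simp add: bij_betw_def)
  have zero: "\<phi> (0\<^sub>v \<gamma>) = 0\<^sub>v \<gamma>"
  proof -
    have "in_row_span G (\<lambda>j. state_map G (0\<^sub>v \<gamma>) j - state_map G (\<phi> (0\<^sub>v \<gamma>)) j)"
      using \<phi>(2)[of "0\<^sub>v \<gamma>"] state_map_zero[OF c(1)] state_map_zero[OF c(2)] by (simp add: deg)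
    thus ?thesis using state_map_inj_mod_row_span[OF c(1) red(1)] \<phi>(1) deg by simp
  qed
  have trans: "in_row_span G' (\<lambda>j. pCons (v $ j) (state_map G' y j) - state_map G' x j) \<longleftrightarrow>
      in_row_span G (\<lambda>j. pCons (v $ j) (state_map G (\<phi> y) j) - state_map G (\<phi> x) j)"
    (is "_ \<longleftrightarrow> in_row_span G ?t") for v x y
  proof -
    let ?t' = "\<lambda>j. pCons (v $ j) (state_map G' y j) - state_map G' x j"
    \<comment> \<open>The difference of the two transition conditions. It lies in the row module by
      the choice of \<open>\<phi>\<close>, and the output \<open>v\<close> cancels.\<close>
    let ?d = "\<lambda>j. [:0, 1:] * (state_map G' y j - state_map G (\<phi> y) j) -
        (state_map G' x j - state_map G (\<phi> x) j)"
    have d: "in_row_span G ?d" by (intro in_row_span_diff in_row_span_mult \<phi>(2))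
    have "?t' = (\<lambda>j. ?t j + ?d j)" "?t = (\<lambda>j. ?t' j - ?d j)" by (auto simp: fun_eq_iff)
    thus ?thesis unfolding span
      using in_row_span_add[OF _ d, of ?t] in_row_span_diff[OF _ d, of ?t'] by metis
  qed
  show ?thesis
  proof (rule that[OF bij zero])
    fix x y :: "'a vec" and \<alpha> assume "x \<in> carrier_vec \<gamma>" "y \<in> carrier_vec \<gamma>"
    thus "input_count G' x y \<alpha> = input_count G (\<phi> x) (\<phi> y) \<alpha>"
      using input_count_eq_output_count[OF c(2) red(2), of x y \<alpha>]
        input_count_eq_output_count[OF c(1) red(1), of "\<phi> x" "\<phi> y" \<alpha>] \<phi>(1) by (simp add: deg trans)
  qed
qed


section \<open>Conjugation by permutation matrices\<close>

text \<open>Conjugation by a permutation matrix relabels rows and columns simultaneously. Later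
  arguments can then work with index permutations in place of matrix products.\<close>

lemma perm_conjugate_iff:
  assumes M: "M \<in> carrier_mat s s" and s: "s > 0"
  shows "perm_conjugate s M N \<longleftrightarrow>
    (\<exists>\<sigma>. \<sigma> permutes {..<s} \<and> \<sigma> 0 = 0 \<and> N = mat s s (\<lambda>(i, j). M $$ (\<sigma> i, \<sigma> j)))"
proof -
  define P :: "(nat \<Rightarrow> nat) \<Rightarrow> rat mat" where
    "P \<sigma> = mat s s (\<lambda>(i, j). if j = \<sigma> i then 1 else 0)" for \<sigma>
  define Q :: "(nat \<Rightarrow> nat) \<Rightarrow> rat mat" where
    "Q \<sigma> = mat s s (\<lambda>(i, j). if i = \<sigma> j then 1 else 0)" for \<sigma>
  have const_if: "[:if b then 1 else 0:] = (if b then 1 else 0 :: rat poly)" for b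
    by (simp add: one_pCons)
  have PQ_carrier: "P \<sigma> \<in> carrier_mat s s" "Q \<sigma> \<in> carrier_mat s s" for \<sigma>
    by (simp_all add: P_def Q_def)
  have PQ: "P \<sigma> * Q \<sigma> = 1\<^sub>m s" if "\<sigma> permutes {..<s}" for \<sigma>
  proof (rule eq_matI)
    fix i j assume "i < dim_row (1\<^sub>m s :: rat mat)" "j < dim_col (1\<^sub>m s :: rat mat)"
    hence ij: "i < s" "j < s" by auto
    have "(P \<sigma> * Q \<sigma>) $$ (i, j) = (\<Sum>r<s. (if r = \<sigma> i then 1 else 0) * (if r = \<sigma> j then 1 else 0))"
      using ij by (simp add: P_def Q_def scalar_prod_def atLeast0LessThan)
    also have "\<dots> = (if \<sigma> i = \<sigma> j then 1 else 0)"
      using permutes_in_image[OF that, of i] ij by (simp add: mult_delta_left)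
    also have "\<dots> = 1\<^sub>m s $$ (i, j)" using ij inj_eq[OF permutes_inj[OF that]] by simp
    finally show "(P \<sigma> * Q \<sigma>) $$ (i, j) = 1\<^sub>m s $$ (i, j)" .
  qed (simp_all add: P_def Q_def)
  have QP: "Q \<sigma> * P \<sigma> = 1\<^sub>m s" if "\<sigma> permutes {..<s}" for \<sigma>
    using mat_mult_left_right_inverse[OF PQ_carrier PQ[OF that]] .
  have conj: "const_poly_mat (P \<sigma>) * M * const_poly_mat (Q \<sigma>) = mat s s (\<lambda>(i, j). M $$ (\<sigma> i, \<sigma> j))"
    if \<sigma>: "\<sigma> permutes {..<s}" for \<sigma>
  proof -
    have lt: "\<sigma> i < s" if "i < s" for i using permutes_in_image[OF \<sigma>, of i] that by simp
    have PM: "const_poly_mat (P \<sigma>) * M = mat s s (\<lambda>(i, j). M $$ (\<sigma> i, j))"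
    proof (rule eq_matI)
      fix i j assume "i < dim_row (mat s s (\<lambda>(i, j). M $$ (\<sigma> i, j)))"
        "j < dim_col (mat s s (\<lambda>(i, j). M $$ (\<sigma> i, j)))"
      hence ij: "i < s" "j < s" by auto
      have "(const_poly_mat (P \<sigma>) * M) $$ (i, j) = (\<Sum>r<s. if r = \<sigma> i then M $$ (r, j) else 0)"
        using ij M
        by (simp add: const_poly_mat_def P_def scalar_prod_def atLeast0LessThan const_if mult_delta_left)
      thus "(const_poly_mat (P \<sigma>) * M) $$ (i, j) = mat s s (\<lambda>(i, j). M $$ (\<sigma> i, j)) $$ (i, j)"
        using ij lt by simp
    qed (use M in \<open>simp_all add: const_poly_mat_def P_def\<close>)
    show ?thesis unfolding PM
    proof (rule eq_matI)
      let ?R = "mat s s (\<lambda>(i, j). M $$ (\<sigma> i, j))"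
      fix i j assume "i < dim_row (mat s s (\<lambda>(i, j). M $$ (\<sigma> i, \<sigma> j)))"
        "j < dim_col (mat s s (\<lambda>(i, j). M $$ (\<sigma> i, \<sigma> j)))"
      hence ij: "i < s" "j < s" by auto
      have "(?R * const_poly_mat (Q \<sigma>)) $$ (i, j) = (\<Sum>r<s. if r = \<sigma> j then M $$ (\<sigma> i, r) else 0)"
        using ij
        by (simp add: const_poly_mat_def Q_def scalar_prod_def atLeast0LessThan const_if mult_delta_right)
      thus "(?R * const_poly_mat (Q \<sigma>)) $$ (i, j) = mat s s (\<lambda>(i, j). M $$ (\<sigma> i, \<sigma> j)) $$ (i, j)"
        using ij lt by simp
    qed (simp_all add: const_poly_mat_def Q_def)
  qed
  show ?thesis
  proof
    assume "perm_conjugate s M N"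
    then obtain \<sigma> R where \<sigma>: "\<sigma> permutes {..<s}" "P \<sigma> $$ (0, 0) = 1"
      and R: "R \<in> carrier_mat s s" "R * P \<sigma> = 1\<^sub>m s"
      and N: "N = const_poly_mat (P \<sigma>) * M * const_poly_mat R"
      by (auto simp: perm_conjugate_def zero_fixing_perm_group_def permutation_matrix_def P_def)
    \<comment> \<open>The inverse is unique, so the given \<open>R\<close> must be the transpose
      \<open>Q \<sigma>\<close>.\<close>
    have "R = R * (P \<sigma> * Q \<sigma>)" using R PQ[OF \<sigma>(1)] by simp
    also have "\<dots> = R * P \<sigma> * Q \<sigma>"
      by (rule assoc_mult_mat[OF R(1) PQ_carrier, symmetric])
    also have "\<dots> = Q \<sigma>" using R(2) left_mult_one_mat[OF PQ_carrier(2)] by simp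
    finally have "N = mat s s (\<lambda>(i, j). M $$ (\<sigma> i, \<sigma> j))" using N conj[OF \<sigma>(1)] by simp
    moreover have "\<sigma> 0 = 0" using \<sigma>(2) s by (auto simp: P_def split: if_splits)
    ultimately show "\<exists>\<sigma>. \<sigma> permutes {..<s} \<and> \<sigma> 0 = 0 \<and> N = mat s s (\<lambda>(i, j). M $$ (\<sigma> i, \<sigma> j))"
      using \<sigma>(1) by blast
  next
    assume "\<exists>\<sigma>. \<sigma> permutes {..<s} \<and> \<sigma> 0 = 0 \<and> N = mat s s (\<lambda>(i, j). M $$ (\<sigma> i, \<sigma> j))"
    then obtain \<sigma> where \<sigma>: "\<sigma> permutes {..<s}" "\<sigma> 0 = 0"
      and N: "N = mat s s (\<lambda>(i, j). M $$ (\<sigma> i, \<sigma> j))" by blast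
    have "P \<sigma> \<in> zero_fixing_perm_group s"
      using \<sigma> s by (auto simp: zero_fixing_perm_group_def permutation_matrix_def P_def)
    moreover have "N = const_poly_mat (P \<sigma>) * M * const_poly_mat (Q \<sigma>)"
      unfolding N by (rule conj[OF \<sigma>(1), symmetric])
    ultimately show "perm_conjugate s M N"
      using PQ_carrier(2) PQ[OF \<sigma>(1)] QP[OF \<sigma>(1)] unfolding perm_conjugate_def by blast
  qed
qed

section \<open>Conjugacy as an equivalence relation\<close>

lemma perm_conjugate_carrier:
  assumes "M \<in> carrier_mat s s" "s > 0" "perm_conjugate s M N"
  shows "N \<in> carrier_mat s s"
  using assms by (auto simp: perm_conjugate_iff)

lemma perm_conjugate_sym:
  assumes M: "M \<in> carrier_mat s s" "s > 0" and MN: "perm_conjugate s M N"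
  shows "perm_conjugate s N M"
proof -
  obtain \<sigma> where \<sigma>: "\<sigma> permutes {..<s}" "\<sigma> 0 = 0" "N = mat s s (\<lambda>(i, j). M $$ (\<sigma> i, \<sigma> j))"
    using MN perm_conjugate_iff[OF M] by blast
  let ?\<tau> = "inv_into UNIV \<sigma>"
  have \<tau>: "?\<tau> permutes {..<s}" by (rule permutes_inv[OF \<sigma>(1)])
  have "?\<tau> 0 = 0" using \<sigma>(1,2) by (simp add: permutes_inv_eq)
  moreover have "M = mat s s (\<lambda>(i, j). N $$ (?\<tau> i, ?\<tau> j))"
    using M(1) permutes_in_image[OF \<tau>] permutes_inverses(1)[OF \<sigma>(1)]
    by (intro eq_matI) (auto simp: \<sigma>(3))
  ultimately show ?thesis
    using perm_conjugate_iff[OF perm_conjugate_carrier[OF M MN] M(2)] \<tau> by blast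
qed

lemma perm_conjugate_trans:
  assumes M: "M \<in> carrier_mat s s" "s > 0"
    and MN: "perm_conjugate s M N" and NL: "perm_conjugate s N L"
  shows "perm_conjugate s M L"
proof -
  obtain \<sigma> where \<sigma>: "\<sigma> permutes {..<s}" "\<sigma> 0 = 0" "N = mat s s (\<lambda>(i, j). M $$ (\<sigma> i, \<sigma> j))"
    using MN perm_conjugate_iff[OF M] by blast
  obtain \<tau> where \<tau>: "\<tau> permutes {..<s}" "\<tau> 0 = 0" "L = mat s s (\<lambda>(i, j). N $$ (\<tau> i, \<tau> j))"
    using NL perm_conjugate_iff[OF perm_conjugate_carrier[OF M MN] M(2)] by blast
  have "L = mat s s (\<lambda>(i, j). M $$ ((\<sigma> \<circ> \<tau>) i, (\<sigma> \<circ> \<tau>) j))"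
    using permutes_in_image[OF \<tau>(1)] by (intro eq_matI) (auto simp: \<sigma>(3) \<tau>(3))
  moreover have "(\<sigma> \<circ> \<tau>) permutes {..<s}" by (rule permutes_compose[OF \<tau>(1) \<sigma>(1)])
  moreover have "(\<sigma> \<circ> \<tau>) 0 = 0" using \<sigma>(2) \<tau>(2) by simp
  ultimately show ?thesis using perm_conjugate_iff[OF M] by blast
qed

lemma equivalence_class_eqI:
  assumes M: "M \<in> carrier_mat s s" "s > 0" and MN: "perm_conjugate s M N"
  shows "equivalence_class s M = equivalence_class s N"
  unfolding equivalence_class_def
proof (intro Collect_cong iffI)
  fix L
  note N = perm_conjugate_carrier[OF M MN] M(2)
  show "perm_conjugate s N L" if "perm_conjugate s M L"
    by (rule perm_conjugate_trans[OF N perm_conjugate_sym[OF M MN] that])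
  show "perm_conjugate s M L" if "perm_conjugate s N L"
    by (rule perm_conjugate_trans[OF M MN that])
qed

section \<open>From the bijection of states to the adjacency matrices\<close>

theorem theorem4p1:
  fixes G G' :: "'a::{field, finite} poly mat"
    and \<C> :: "'a fls vec set"
    and X X' :: "nat \<Rightarrow> 'a vec"
    and k n \<gamma> s :: nat
  assumes "convolutional_code k n \<C>"
    and "minimal_generator_matrix k n \<C> G"
    and "minimal_generator_matrix k n \<C> G'"
    and "\<gamma> = overall_constraint_length k n \<C>"
    and "\<gamma> > 0"
    and "s = CARD('a) ^ \<gamma>"
    and "state_ordering \<gamma> X"
    and "state_ordering \<gamma> X'"
  shows "equivalence_class s (adjacency_matrix s G X) = equivalence_class s (adjacency_matrix s G' X')
    \<and> perm_conjugate s (adjacency_matrix s G X) (adjacency_matrix s G' X')"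
proof -
  obtain \<phi> where \<phi>: "bij_betw \<phi> (carrier_vec \<gamma>) (carrier_vec \<gamma>)" "\<phi> (0\<^sub>v \<gamma>) = 0\<^sub>v \<gamma>"
    "\<And>x y \<alpha>. x \<in> carrier_vec \<gamma> \<Longrightarrow> y \<in> carrier_vec \<gamma> \<Longrightarrow>
      input_count G' x y \<alpha> = input_count G (\<phi> x) (\<phi> y) \<alpha>"
    using state_bijection[OF assms(2-5)] by blast
  have c: "G \<in> carrier_mat k n" "G' \<in> carrier_mat k n"
    using assms(2,3)
    by (simp_all add: minimal_generator_matrix_def generator_matrix_def basic_mat_def)
  have X: "bij_betw X {..<s} (carrier_vec \<gamma>)" "X 0 = 0\<^sub>v \<gamma>"
    and X': "bij_betw X' {..<s} (carrier_vec \<gamma>)" "X' 0 = 0\<^sub>v \<gamma>"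
    using assms(6-8) by (simp_all add: state_ordering_def)
  have s: "s > 0" by (simp add: assms(6))
  have transition_count_eq: "transition_count M Y i j \<alpha> =
      (if i = 0 \<and> j = 0 \<and> \<alpha> = 0 then 0 else input_count M (Y i) (Y j) \<alpha>)"
    for M :: "'a poly mat" and Y i j \<alpha>
    by (simp add: transition_count_def input_count_def)
  \<comment> \<open>The bijection \<open>\<phi>\<close> read through the two orderings, extended by
    the identity as \<open>permutes\<close> demands.\<close>
  define \<sigma> where "\<sigma> i = (if i < s then inv_into {..<s} X (\<phi> (X' i)) else i)" for i
  have "bij_betw (inv_into {..<s} X \<circ> (\<phi> \<circ> X')) {..<s} {..<s}"
    by (intro bij_betw_trans[OF bij_betw_trans[OF X'(1) \<phi>(1)]] bij_betw_inv_into X(1))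
  hence "bij_betw \<sigma> {..<s} {..<s}"
    by (rule bij_betw_cong[THEN iffD1, rotated]) (simp add: \<sigma>_def)
  hence perm: "\<sigma> permutes {..<s}" by (rule bij_imp_permutes) (simp add: \<sigma>_def)
  have in_carrier: "X' i \<in> carrier_vec \<gamma>" if "i < s" for i
    using X'(1) that by (auto dest: bij_betwE)
  have X\<sigma>: "X (\<sigma> i) = \<phi> (X' i)" if "i < s" for i
    using bij_betwE[OF \<phi>(1)] in_carrier[OF that] that
    by (auto simp: \<sigma>_def intro!: bij_betw_inv_into_right[OF X(1)])
  have \<sigma>0: "\<sigma> 0 = 0"
    using bij_betw_inv_into_left[OF X(1), of 0] s X X' \<phi>(2) by (simp add: \<sigma>_def)
  \<comment> \<open>Needed in both directions, so that the exceptional value for the zero loop sits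
    at corresponding entries of both matrices.\<close>
  hence \<sigma>_eq_0: "\<sigma> i = 0 \<longleftrightarrow> i = 0" for i
    using inj_eq[OF permutes_inj[OF perm], of i 0] by simp
  have "transition_count G' X' i j \<alpha> = transition_count G X (\<sigma> i) (\<sigma> j) \<alpha>" if "i < s" "j < s" for i j \<alpha>
    using \<phi>(3)[OF in_carrier[OF that(1)] in_carrier[OF that(2)]] that
    by (simp add: transition_count_eq \<sigma>_eq_0 X\<sigma>)
  hence "adjacency_matrix s G' X' = mat s s (\<lambda>(i, j). adjacency_matrix s G X $$ (\<sigma> i, \<sigma> j))"
    using c permutes_in_image[OF perm] by (intro eq_matI) (auto simp: adjacency_matrix_def)
  moreover have M: "adjacency_matrix s G X \<in> carrier_mat s s" by (simp add: adjacency_matrix_def)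
  ultimately have "perm_conjugate s (adjacency_matrix s G X) (adjacency_matrix s G' X')"
    using perm \<sigma>0 perm_conjugate_iff[OF M s] by blast
  thus ?thesis using equivalence_class_eqI[OF M s] by blast
qed

end
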